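(* Let $n\ge2$, $\mathbf t=(t_0,u_0,t,t_n,u_n)\in\mathbb C^5$ and $\mathbf t^\sigma=(u_n,u_0,t,t_n,t_0)$. Write $\gamma_\lambda=\gamma_\lambda(\mathbf t)$ and $x_\mu=\gamma_\mu(\mathbf t^\sigma)$ for $\lambda,\mu\in\Lambda=\mathbb Z^n$. Assume the parameters are generic, in the sense that $\gamma_\lambda\ne\gamma_\mu$ and $x_\lambda\ne x_\mu$ for $\lambda\ne\mu$, and that $p_\lambda(-x_0;\mathbf t)\ne0$ and $p_\lambda(-\gamma_0;\mathbf t^\sigma)\neq0$ for all $\lambda\in\Lambda$. Let $E(\cdot,\gamma_\lambda;\mathbf t)$ be the constant multiple of $p_\lambda(\cdot;\mathbf t)$ that takes the value $1$ at $-x_0$, and let $E(\cdot,x_\mu;\mathbf t^\sigma)$ be the constant multiple of $p_\mu(\cdot;\mathbf t^\sigma)$ that takes the value $1$ at $-\gamma_0$. Then for all $\lambda,\mu\in\Lambda$ $$E(-x_\mu,\gamma_\lambda;\mathbf t)=E(-\gamma_\lambda,x_\mu;\mathbf t^\sigma).$$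
   Context: Notation: $[m,n]=\{m,m+1,\dots,n\}$, $\mathcal P=\mathbb C[x_1,\dots,x_n]$, $\Lambda=\mathbb Z^n$. $W$ is the affine Weyl group of type $\widetilde C_n$, the Coxeter group with generators $s_0,\dots,s_n$, realized faithfully on $\mathbb C^n$ by $s_0x=(1-x_1,x_2,\dots,x_n)$, $s_i$ interchanging $x_i$ and $x_{i+1}$ ($i\in[1,n-1]$), $s_nx=(x_1,\dots,x_{n-1},-x_n)$; it acts on functions by $(wp)(x)=p(w^{-1}x)$. Put $a_0(x)=1-2x_1$, $a_i(x)=x_i-x_{i+1}$ ($i\in[1,n-1]$), $a_n(x)=2x_n$. Operators on $\mathcal P$, for parameters $\mathbf t=(t_0,u_0,t,t_n,u_n)$: $X_i$ is multiplication by $x_i$, and $T_ip=\chi_i\,s_ip+d_i\,(s_ip-p)$ ($i\in[0,n]$), where $\chi_0=t_0$, $\chi_n=t_n$, $\chi_i=1$ for $i\in[1,n-1]$, $d_0(x)=\frac{t_0^2-u_0^2+(\frac12-x_1)^2}{1-2x_1}$, $d_i(x)=\frac{t}{x_i-x_{i+1}}$ ($i\in[1,n-1]$), $d_n(x)=\frac{t_n^2-u_n^2+x_n^2}{2x_n}$. For $1\le i<j\le n$ put $T_{i,j}=T_iT_{i+1}\cdots T_{j-2}T_{j-1}T_{j-2}\cdots T_{i+1}T_i$. The operators $$Y_i=T_i\cdots T_{n-1}T_nT_{n-1}\cdots T_i+T_{i-1}\cdots T_1T_0T_1\cdots T_{i-1}+t\sum_{j=i+1}^nT_{i,j}\qquad(i\in[1,n])$$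 commute pairwise, and $f(Y)$ denotes $f$ evaluated at $(Y_1,\dots,Y_n)$. Put $U_n=T_1\cdots T_{n-1}(-X_n-T_n)T_{n-1}\cdots T_1$. Intertwiners: $S_0=[U_n,a_0(Y)]$, $S_i=[T_i,a_i(Y)]$ ($i\in[1,n]$). They satisfy the braid relations of $W$, so $S_w=S_{i_1}\cdots S_{i_r}$ for a reduced expression $w=s_{i_1}\cdots s_{i_r}$ is well defined ($S_1=1$). The dot action of $W$ on $\mathbb C^n$ is $s_i\cdot x=s_ix$ for $i\in[1,n]$ and $s_0\cdot x=(-x_1-1,x_2,\dots,x_n)$; it preserves $\Lambda$. For $\lambda\in\Lambda$, $u_\lambda$ is the unique shortest element of $W$ (length with respect to $s_0,\dots,s_n$) with $u_\lambda\cdot0=\lambda$. The nonsymmetric multivariable Wilson polynomial is $p_\lambda=p_\lambda(\cdot;\mathbf t)=S_{u_\lambda}1\in\mathcal P$. Finally $\gamma_0(\mathbf t)=(\gamma_{0,1},\dots,\gamma_{0,n})$ with $\gamma_{0,i}=t_0+t_n+(n-i)t$ and $\gamma_\lambda(\mathbf t)=u_\lambda\cdot\gamma_0(\mathbf t)$. In particular $x_0=\gamma_0(\mathbf t^\sigma)$ has components $x_{0,i}=t_n+u_n+(n-i)t$. Objects for $\mathbf t^\sigma$ are obtained by replacing $(t_0,u_0,t,t_n,u_n)$ by $(u_n,u_0,t,t_n,t_0)$ everywhere. *)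

theory Defs
  imports Complex_Main "HOL-Combinatorics.Transposition"
begin

section \<open>Points and polynomials\<close>

text \<open>
  A point of complex \<open>n\<close>-space is a function \<open>x\<close> on the natural numbers whose coordinates are
  \<open>x 1, \<dots>, x n\<close> and which is \<open>0\<close> at all other indices. A polynomial in \<open>n\<close> variables
  is identified with the polynomial function it induces (the complex field is infinite). Such
  a function looks only at the coordinates \<open>1, \<dots>, n\<close> of its argument.
\<close>

type_synonym point = "nat \<Rightarrow> complex"
type_synonym pfun = "point \<Rightarrow> complex"
type_synonym pop = "pfun \<Rightarrow> pfun"

inductive_set polys :: "nat \<Rightarrow> pfun set" for n :: nat where
  const: "(\<lambda>x. c) \<in> polys n"
| coord: "i \<in> {1..n} \<Longrightarrow> (\<lambda>x. x i) \<in> polys n"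
| add: "p \<in> polys n \<Longrightarrow> q \<in> polys n \<Longrightarrow> (\<lambda>x. p x + q x) \<in> polys n"
| mult: "p \<in> polys n \<Longrightarrow> q \<in> polys n \<Longrightarrow> (\<lambda>x. p x * q x) \<in> polys n"

definition Lam :: "nat \<Rightarrow> point set" where
  "Lam n = {x. (\<forall>i\<in>{1..n}. x i \<in> \<int>) \<and> (\<forall>i. i \<notin> {1..n} \<longrightarrow> x i = 0)}"


section \<open>The affine Weyl group\<close>

definition refl_gen :: "nat \<Rightarrow> nat \<Rightarrow> point \<Rightarrow> point" where
  "refl_gen n i x =
     (if i = 0 then x(1 := 1 - x 1)
      else if i = n then x(n := - x n)
      else x \<circ> transpose i (i + 1))"

definition dot_gen :: "nat \<Rightarrow> nat \<Rightarrow> point \<Rightarrow> point" where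
  "dot_gen n i x = (if i = 0 then x(1 := - x 1 - 1) else refl_gen n i x)"

definition word_comp :: "(nat \<Rightarrow> 'a \<Rightarrow> 'a) \<Rightarrow> nat list \<Rightarrow> 'a \<Rightarrow> 'a" where
  "word_comp g is = foldr (\<lambda>i f. g i \<circ> f) is id"

text \<open>
  The group is identified with its image under the faithful realization; an expression
  \<open>s\<^sub>i\<^sub>1 \<cdots> s\<^sub>i\<^sub>r\<close> is encoded as the list \<open>[i1, \<dots>, ir]\<close>.
\<close>

definition Weyl :: "nat \<Rightarrow> (point \<Rightarrow> point) set" where
  "Weyl n = word_comp (refl_gen n) ` {is. set is \<subseteq> {0..n}}"

definition expression :: "nat \<Rightarrow> (point \<Rightarrow> point) \<Rightarrow> nat list \<Rightarrow> bool" where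
  "expression n w is \<longleftrightarrow> set is \<subseteq> {0..n} \<and> word_comp (refl_gen n) is = w"

definition wlength :: "nat \<Rightarrow> (point \<Rightarrow> point) \<Rightarrow> nat" where
  "wlength n w = (LEAST r. \<exists>is. expression n w is \<and> length is = r)"

definition reduced_expr :: "nat \<Rightarrow> (point \<Rightarrow> point) \<Rightarrow> nat list" where
  "reduced_expr n w = (SOME is. expression n w is \<and> length is = wlength n w)"

definition act :: "(point \<Rightarrow> point) \<Rightarrow> pfun \<Rightarrow> pfun" where
  "act w p = (\<lambda>x. p (inv w x))"

text \<open>
  The dot action is given on generators; by \<open>dot_word_cong\<close> below, the choice of the expression
  for \<open>w\<close> does not matter.
\<close>

definition dot :: "nat \<Rightarrow> (point \<Rightarrow> point) \<Rightarrow> point \<Rightarrow> point" where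
  "dot n w = word_comp (dot_gen n) (reduced_expr n w)"

lemma dot_gen_conv: "n \<ge> 1 \<Longrightarrow> dot_gen n i x = - refl_gen n i (- x)"
  by (auto simp: dot_gen_def refl_gen_def fun_eq_iff)

lemma dot_word_conv: "n \<ge> 1 \<Longrightarrow> word_comp (dot_gen n) is x = - word_comp (refl_gen n) is (- x)"
  by (induction "is") (simp_all add: word_comp_def dot_gen_conv fun_Compl_def)

lemma dot_word_cong:
  assumes "n \<ge> 1" and "word_comp (refl_gen n) is = word_comp (refl_gen n) js"
  shows "word_comp (dot_gen n) is = word_comp (dot_gen n) js"
  using assms by (simp add: fun_eq_iff dot_word_conv)

text \<open>
  The minimizer is unique for \<open>lam\<close> in the lattice, so the choice made here is the
  unique shortest element.
\<close>

definition u_elt :: "nat \<Rightarrow> point \<Rightarrow> point \<Rightarrow> point" where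
  "u_elt n lam = (ARG_MIN (wlength n) w. w \<in> Weyl n \<and> dot n w (\<lambda>_. 0) = lam)"


section \<open>The operators\<close>

datatype params =
  Params (par_t0: complex) (par_u0: complex) (par_t: complex) (par_tn: complex) (par_un: complex)

fun sigma :: "params \<Rightarrow> params" where
  "sigma (Params t0 u0 t tn un) = Params un u0 t tn t0"

definition a_fun :: "nat \<Rightarrow> nat \<Rightarrow> point \<Rightarrow> complex" where
  "a_fun n i x =
     (if i = 0 then 1 - 2 * x 1 else if i = n then 2 * x n else x i - x (i + 1))"

definition chi :: "nat \<Rightarrow> params \<Rightarrow> nat \<Rightarrow> complex" where
  "chi n P i = (if i = 0 then par_t0 P else if i = n then par_tn P else 1)"

definition d_fun :: "nat \<Rightarrow> params \<Rightarrow> nat \<Rightarrow> point \<Rightarrow> complex" where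
  "d_fun n P i x =
     (if i = 0 then ((par_t0 P)\<^sup>2 - (par_u0 P)\<^sup>2 + (1/2 - x 1)\<^sup>2) / (1 - 2 * x 1)
      else if i = n then ((par_tn P)\<^sup>2 - (par_un P)\<^sup>2 + (x n)\<^sup>2) / (2 * x n)
      else par_t P / (x i - x (i + 1)))"

text \<open>
  The right-hand side of the formula for \<open>T\<^sub>i p\<close> is a polynomial once the division is carried
  out. It is pinned down by its values off the hyperplane where the denominator \<open>a\<^sub>i\<close> of
  \<open>d\<^sub>i\<close> vanishes; on the hyperplane itself HOL's \<open>z / 0 = 0\<close> would give wrong values.
\<close>

definition T_op :: "nat \<Rightarrow> params \<Rightarrow> nat \<Rightarrow> pop" where
  "T_op n P i p = (THE q. q \<in> polys n \<and>
     (\<forall>x. a_fun n i x \<noteq> 0 \<longrightarrow>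
        q x = chi n P i * act (refl_gen n i) p x
              + d_fun n P i x * (act (refl_gen n i) p x - p x)))"

definition X_op :: "nat \<Rightarrow> pop" where
  "X_op i p = (\<lambda>x. x i * p x)"

definition T_word :: "nat \<Rightarrow> params \<Rightarrow> nat list \<Rightarrow> pop" where
  "T_word n P = word_comp (T_op n P)"

definition T_pair :: "nat \<Rightarrow> params \<Rightarrow> nat \<Rightarrow> nat \<Rightarrow> pop" where
  "T_pair n P i j = T_word n P ([i..<j-1] @ [j-1] @ rev [i..<j-1])"

definition Y_op :: "nat \<Rightarrow> params \<Rightarrow> nat \<Rightarrow> pop" where
  "Y_op n P i p = (\<lambda>x.
     T_word n P ([i..<n] @ [n] @ rev [i..<n]) p x
     + T_word n P (rev [1..<i] @ [0] @ [1..<i]) p x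
     + par_t P * (\<Sum>j=i+1..n. T_pair n P i j p x))"

definition U_op :: "nat \<Rightarrow> params \<Rightarrow> pop" where
  "U_op n P = T_word n P [1..<n] \<circ> (\<lambda>p x. - X_op n p x - T_op n P n p x) \<circ> T_word n P (rev [1..<n])"

text \<open>The operator \<open>a\<^sub>i(Y)\<close>, that is, \<open>a_fun\<close> with \<open>Y\<^sub>1, \<dots>, Y\<^sub>n\<close> in place of the coordinates.\<close>

definition aY_op :: "nat \<Rightarrow> params \<Rightarrow> nat \<Rightarrow> pop" where
  "aY_op n P i p = (\<lambda>x.
     if i = 0 then p x - 2 * Y_op n P 1 p x
     else if i = n then 2 * Y_op n P n p x
     else Y_op n P i p x - Y_op n P (i + 1) p x)"

definition commutator :: "pop \<Rightarrow> pop \<Rightarrow> pop" where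
  "commutator A B p = (\<lambda>x. A (B p) x - B (A p) x)"

definition S_gen :: "nat \<Rightarrow> params \<Rightarrow> nat \<Rightarrow> pop" where
  "S_gen n P i = commutator (if i = 0 then U_op n P else T_op n P i) (aY_op n P i)"

definition S_op :: "nat \<Rightarrow> params \<Rightarrow> (point \<Rightarrow> point) \<Rightarrow> pop" where
  "S_op n P w = word_comp (S_gen n P) (reduced_expr n w)"


section \<open>Nonsymmetric Wilson polynomials and their renormalizations\<close>

definition wilson :: "nat \<Rightarrow> params \<Rightarrow> point \<Rightarrow> pfun" where
  "wilson n P lam = S_op n P (u_elt n lam) (\<lambda>x. 1)"

definition gamma0 :: "nat \<Rightarrow> params \<Rightarrow> point" where
  "gamma0 n P i =
     (if i \<in> {1..n} then par_t0 P + par_tn P + of_nat (n - i) * par_t P else 0)"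

definition gam :: "nat \<Rightarrow> params \<Rightarrow> point \<Rightarrow> point" where
  "gam n P lam = dot n (u_elt n lam) (gamma0 n P)"

text \<open>
  \<open>E_fun n P g\<close> is the function \<open>E(\<cdot>, g; t)\<close>, for \<open>g\<close> one of the points \<open>\<gamma>\<^sub>\<lambda>\<close>.
  The normalization point is \<open>- x\<^sub>0 = - \<gamma>\<^sub>0(t\<^sup>\<sigma>)\<close>; with \<open>sigma P\<close> in place of \<open>P\<close> it becomes
  \<open>- \<gamma>\<^sub>0(t)\<close>, since \<open>sigma\<close> is an involution.
\<close>

definition E_fun :: "nat \<Rightarrow> params \<Rightarrow> point \<Rightarrow> pfun" where
  "E_fun n P g = (THE f. (\<exists>lam\<in>Lam n. g = gam n P lam \<and> (\<exists>c. f = (\<lambda>x. c * wilson n P lam x)))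
                    \<and> f (- gamma0 n (sigma P)) = 1)"

end

theory Submission
  imports Defs "HOL-Library.Function_Algebras" "HOL-Computational_Algebra.Polynomial"
begin

text \<open>
  Let \<open>{f, g} = (f(-Y) g)(-x\<^sub>0)\<close>. Exchanging \<open>X\<^sub>i\<close> with \<open>-Y\<^sub>i\<close> and \<open>T\<^sub>0\<close> with \<open>U\<^sub>n\<close> preserves
  the relations between these operators and \<open>T\<^sub>1, \<dots>, T\<^sub>n\<close>, while \<open>T\<^sub>i\<close> and \<open>U\<^sub>n\<close> act on
  evaluation at \<open>-x\<^sub>0\<close> by the scalars by which the dual \<open>T\<^sub>i\<close> and \<open>T\<^sub>0\<close> act on \<open>1\<close>. Hence
  \<open>{f, T\<^sub>i g} = {T\<^sub>i f, g}\<close>, \<open>{f, U\<^sub>n g} = {T\<^sub>0 f, g}\<close> and so \<open>{f, X\<^sub>i g} = {-Y\<^sub>i f, g}\<close>, where the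
  operators on \<open>f\<close> are those for the dual parameters. Since \<open>{f, 1} = f(-\<gamma>\<^sub>0)\<close>, it follows that
  \<open>{f, g}\<close> equals \<open>{g, f}\<close> for the dual parameters. Each \<open>p\<^sub>\<lambda>\<close> is a joint eigenfunction of the
  \<open>Y\<^sub>i\<close> with eigenvalue \<open>\<gamma>\<^sub>\<lambda>\<close>, so evaluating the symmetry at \<open>f = p\<^sub>\<mu>\<close> (dual) and
  \<open>g = p\<^sub>\<lambda>\<close> gives the theorem.
\<close>

section \<open>Polynomial functions\<close>

text \<open>Named constants and coordinates let operator identities be stated in the pointwise ring
  of functions, where ring simplification applies.\<close>

definition cst :: "complex \<Rightarrow> pfun" where "cst c = (\<lambda>x. c)"
definition crd :: "nat \<Rightarrow> pfun" where "crd i = (\<lambda>x. x i)"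

lemma cst_apply [simp]: "cst c x = c" by (simp add: cst_def)
lemma crd_apply [simp]: "crd i x = x i" by (simp add: crd_def)

lemma cst_0 [simp]: "cst 0 = 0" and cst_1 [simp]: "cst 1 = 1"
  by (simp_all add: fun_eq_iff)

lemma cst_polys [intro, simp]: "cst c \<in> polys n"
  by (simp add: cst_def polys.const)

lemma zero_polys [intro, simp]: "0 \<in> polys n" and one_polys [intro, simp]: "1 \<in> polys n"
  using cst_polys[of 0 n] cst_polys[of 1 n] by simp_all

lemma crd_polys [intro, simp]: "i \<in> {1..n} \<Longrightarrow> crd i \<in> polys n"
  by (simp add: crd_def polys.coord)

lemma add_polys [intro, simp]: "p \<in> polys n \<Longrightarrow> q \<in> polys n \<Longrightarrow> p + q \<in> polys n"
  using polys.add[of p n q] by (simp add: plus_fun_def)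

lemma mult_polys [intro, simp]: "p \<in> polys n \<Longrightarrow> q \<in> polys n \<Longrightarrow> p * q \<in> polys n"
  using polys.mult[of p n q] by (simp add: times_fun_def)

lemma uminus_polys [intro, simp]: "p \<in> polys n \<Longrightarrow> - p \<in> polys n"
proof -
  assume "p \<in> polys n"
  moreover have "- p = cst (-1) * p" by (simp add: fun_eq_iff)
  ultimately show ?thesis by simp
qed

lemma diff_polys [intro, simp]: "p \<in> polys n \<Longrightarrow> q \<in> polys n \<Longrightarrow> p - q \<in> polys n"
  using add_polys[of p n "- q"] by simp

lemma polys_line:
  assumes "p \<in> polys n"
  shows "\<exists>r. \<forall>z. p (\<lambda>k. x k + z * v k) = poly r z"
  using assms
proof induction
  case (const c)
  show ?case by (rule exI[of _ "[:c:]"]) simp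
next
  case (coord i)
  show ?case by (rule exI[of _ "[:x i, v i:]"]) simp
next
  case (add p q)
  then show ?case by (metis poly_add)
next
  case (mult p q)
  then show ?case by (metis poly_mult)
qed

text \<open>On the line through \<open>y\<close> and \<open>x\<close> both factors become univariate
  polynomials, and a product of nonzero ones is nonzero.\<close>

lemma polys_no_zero_divisors:
  assumes "p \<in> polys n" "q \<in> polys n" "\<And>x. p x * q x = 0" "p y \<noteq> 0"
  shows "q x = 0"
proof (rule ccontr)
  assume "q x \<noteq> 0"
  define l where "l z = (\<lambda>k. y k + z * (x k - y k))" for z
  obtain r s where r: "\<And>z. p (l z) = poly r z" and s: "\<And>z. q (l z) = poly s z"
    using polys_line[OF assms(1)] polys_line[OF assms(2)] unfolding l_def by metis
  have "poly (r * s) z = 0" for z using assms(3)[of "l z"] by (simp add: r s)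
  then have "r * s = 0" using poly_all_0_iff_0[of "r * s"] by blast
  moreover have "r \<noteq> 0" using r[of 0] assms(4) by (auto simp: l_def)
  moreover have "s \<noteq> 0" using s[of 1] \<open>q x \<noteq> 0\<close> by (auto simp: l_def)
  ultimately show False by simp
qed

text \<open>A density argument: formulas with denominators need to be compared only where a nonzero
  polynomial \<open>D\<close>, typically the product of the denominators, does not vanish.\<close>

lemma polys_eqI:
  assumes "D \<in> polys n" "D y \<noteq> 0" "p \<in> polys n" "q \<in> polys n"
    and "\<And>x. D x \<noteq> 0 \<Longrightarrow> p x = q x"
  shows "p = q"
proof
  fix x
  have "(p - q) x = 0"
  proof (rule polys_no_zero_divisors[where q = "p - q", OF assms(1) _ _ assms(2)])
    show "D x * (p - q) x = 0" for x using assms(5)[of x] by auto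
  qed (use assms in auto)
  then show "p x = q x" by simp
qed

section \<open>The operators T\<close>

locale wilson_ops =
  fixes n :: nat and P :: params
  assumes n2: "n \<ge> 2"
begin

abbreviation V where "V \<equiv> polys n"
abbreviation s where "s \<equiv> refl_gen n"
abbreviation a where "a \<equiv> a_fun n"
abbreviation d where "d \<equiv> d_fun n P"
abbreviation c where "c \<equiv> chi n P"
abbreviation T where "T \<equiv> T_op n P"
abbreviation Y where "Y \<equiv> Y_op n P"
abbreviation U where "U \<equiv> U_op n P"
abbreviation t0 where "t0 \<equiv> par_t0 P"
abbreviation u0 where "u0 \<equiv> par_u0 P"
abbreviation t where "t \<equiv> par_t P"
abbreviation tn where "tn \<equiv> par_tn P"
abbreviation un where "un \<equiv> par_un P"

text \<open>The numerator of \<open>d_i\<close> over the denominator \<open>a_i\<close>. It is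
  invariant under \<open>s_i\<close>, so \<open>d_i\<close> changes sign under
  \<open>s_i\<close>.\<close>

definition num :: "nat \<Rightarrow> pfun" where
  "num i = (if i = 0 then cst (t0\<^sup>2 - u0\<^sup>2) + (cst (1/2) - crd 1) * (cst (1/2) - crd 1)
     else if i = n then cst (tn\<^sup>2 - un\<^sup>2) + crd n * crd n else cst t)"

lemma d_eq: "d i x = num i x / a i x"
  using n2 by (simp add: d_fun_def num_def a_fun_def power2_eq_square)

lemma num_polys [simp]: "i \<le> n \<Longrightarrow> num i \<in> V"
  using n2 by (auto simp: num_def)

lemma a_polys [simp]: "i \<le> n \<Longrightarrow> a i \<in> V"
proof -
  assume "i \<le> n"
  have "a i = (if i = 0 then cst 1 - cst 2 * crd 1 else if i = n then cst 2 * crd n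
      else crd i - crd (i+1))"
    by (auto simp: fun_eq_iff a_fun_def)
  then show ?thesis using n2 \<open>i \<le> n\<close> by auto
qed

lemma a_nonzero: "\<exists>y. a i y \<noteq> 0"
  \<comment> \<open>At this point \<open>a_i\<close> is -3 for \<open>i = 0\<close>, 2 for
    \<open>i = n\<close>, and -1 otherwise.\<close>
  by (rule exI[of _ "\<lambda>k. if k = i then 1 else if k = Suc i then 2 else 0"])
    (auto simp: a_fun_def)

lemma s_s [simp]: "s i (s i x) = x"
  by (auto simp: refl_gen_def fun_eq_iff)

lemma act_s [simp]: "act (s i) p x = p (s i x)"
  unfolding act_def by (metis s_s inv_equality)

lemma a_s [simp]: "a i (s i x) = - a i x"
  using n2 by (auto simp: a_fun_def refl_gen_def)

lemma num_s [simp]: "num i (s i x) = num i x"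
  using n2 by (auto simp: num_def refl_gen_def field_simps)

lemma d_s [simp]: "d i (s i x) = - d i x"
  by (simp add: d_eq)

lemma s_fix: "i \<le> n \<Longrightarrow> a i x = 0 \<Longrightarrow> s i x = x"
  by (auto simp: a_fun_def refl_gen_def fun_eq_iff transpose_def split: if_splits)

lemma s_polys:
  assumes "p \<in> V" "i \<le> n"
  shows "(\<lambda>x. p (s i x)) \<in> V"
  using assms(1)
proof induction
  case (coord j)
  have "crd 1 \<in> V" "crd n \<in> V" using n2 by auto
  moreover have "(\<lambda>x. s i x j) = (if i = 0 then if j = 1 then cst 1 - crd 1 else crd j
     else if i = n then if j = n then - crd n else crd j
     else if j = i then crd (i+1) else if j = i+1 then crd i else crd j)"
    using assms(2) by (auto simp: refl_gen_def fun_eq_iff transpose_def)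
  ultimately show ?case using coord assms(2) by auto
qed (auto intro: polys.intros)

text \<open>Divisibility by \<open>a_i\<close> passes from the coordinates to sums and products; it
  makes the division in \<open>T_i\<close> exact.\<close>

lemma divided_difference:
  assumes "p \<in> V" "i \<le> n"
  shows "\<exists>r\<in>V. \<forall>x. p (s i x) - p x = a i x * r x"
  using assms(1)
proof induction
  case (const k)
  show ?case by (rule bexI[of _ "cst 0"]) auto
next
  case (coord j)
  show ?case
    by (rule bexI[of _ "cst (if i = 0 then (if j = 1 then 1 else 0)
       else if i = n then (if j = n then -1 else 0)
       else if j = i then -1 else if j = i+1 then 1 else 0)"])
      (use n2 in \<open>auto simp: refl_gen_def a_fun_def transpose_def\<close>)
next
  case (add p q)
  then obtain r r' where "r \<in> V" "r' \<in> V" "\<forall>x. p (s i x) - p x = a i x * r x"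
     "\<forall>x. q (s i x) - q x = a i x * r' x" by blast
  then show ?case by (intro bexI[of _ "r + r'"]) (auto simp: algebra_simps)
next
  case (mult p q)
  then obtain r r' where *: "r \<in> V" "r' \<in> V" "\<forall>x. p (s i x) - p x = a i x * r x"
     "\<forall>x. q (s i x) - q x = a i x * r' x" by blast
  then have **: "p (s i x) = p x + a i x * r x" "q (s i x) = q x + a i x * r' x" for x
    by (metis add_diff_cancel_left' add_diff_eq)+
  \<comment> \<open>Twisted Leibniz rule: \<open>(p q)(s_i x) - (p q)(x)\<close> is
    \<open>a_i\<close> times \<open>r (q o s_i) + p r'\<close>.\<close>
  show ?case
  proof (rule bexI[of _ "r * (\<lambda>x. q (s i x)) + p * r'"])
    show "r * (\<lambda>x. q (s i x)) + p * r' \<in> V"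
      using * mult assms(2) by (intro add_polys mult_polys s_polys) auto
  qed (auto simp: ** algebra_simps)
qed

text \<open>Existence comes from the exact quotient \<open>r\<close>, uniqueness from density of the
  complement of the hyperplane. This justifies the \<open>THE\<close> in
  \<open>T_op\<close>.\<close>

lemma T_ex1:
  assumes "p \<in> V" "i \<le> n"
  shows "\<exists>!q. q \<in> V \<and> (\<forall>x. a i x \<noteq> 0 \<longrightarrow>
    q x = c i * act (s i) p x + d i x * (act (s i) p x - p x))"
proof -
  obtain r where r: "r \<in> V" "\<And>x. p (s i x) - p x = a i x * r x"
    using divided_difference[OF assms] by blast
  obtain y where y: "a i y \<noteq> 0" using a_nonzero by blast
  show ?thesis
  proof (rule ex1I[of _ "cst (c i) * (\<lambda>x. p (s i x)) + num i * r"])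
    show "cst (c i) * (\<lambda>x. p (s i x)) + num i * r \<in> V \<and> (\<forall>x. a i x \<noteq> 0 \<longrightarrow>
      (cst (c i) * (\<lambda>x. p (s i x)) + num i * r) x
        = c i * act (s i) p x + d i x * (act (s i) p x - p x))"
      using assms r by (auto simp: s_polys d_eq)
  next
    fix q
    assume "q \<in> V \<and> (\<forall>x. a i x \<noteq> 0 \<longrightarrow>
        q x = c i * act (s i) p x + d i x * (act (s i) p x - p x))"
    then show "q = cst (c i) * (\<lambda>x. p (s i x)) + num i * r"
      using assms r by (intro polys_eqI[OF a_polys[OF assms(2)] y]) (auto simp: s_polys d_eq)
  qed
qed

lemma T_polys [simp]: "p \<in> V \<Longrightarrow> i \<le> n \<Longrightarrow> T i p \<in> V"
  using theI'[OF T_ex1] unfolding T_op_def by blast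

lemma T_apply:
  "p \<in> V \<Longrightarrow> i \<le> n \<Longrightarrow> a i x \<noteq> 0 \<Longrightarrow> T i p x = c i * p (s i x) + d i x * (p (s i x) - p x)"
  using theI'[OF T_ex1, of p i] unfolding T_op_def act_s by blast

text \<open>The working form of the definition: the relations of a single \<open>T_i\<close> with
  itself and with the coordinates are all verified through it.\<close>

lemma T_eqI:
  assumes "p \<in> V" "i \<le> n" "q \<in> V"
    and "\<And>x. a i x \<noteq> 0 \<Longrightarrow> q x = c i * p (s i x) + d i x * (p (s i x) - p x)"
  shows "T i p = q"
proof -
  obtain y where y: "a i y \<noteq> 0" using a_nonzero by blast
  show ?thesis
    by (rule polys_eqI[OF a_polys[OF assms(2)] y]) (use assms in \<open>auto simp: T_apply\<close>)
qed

lemma T_add [simp]: "p \<in> V \<Longrightarrow> q \<in> V \<Longrightarrow> i \<le> n \<Longrightarrow> T i (p + q) = T i p + T i q"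
  by (rule T_eqI) (auto simp: T_apply algebra_simps)

lemma T_cst_mult [simp]: "p \<in> V \<Longrightarrow> i \<le> n \<Longrightarrow> T i (cst k * p) = cst k * T i p"
  by (rule T_eqI) (auto simp: T_apply algebra_simps)

lemma T_uminus [simp]: "p \<in> V \<Longrightarrow> i \<le> n \<Longrightarrow> T i (- p) = - T i p"
  by (rule T_eqI) (auto simp: T_apply algebra_simps)

lemma T_diff [simp]: "p \<in> V \<Longrightarrow> q \<in> V \<Longrightarrow> i \<le> n \<Longrightarrow> T i (p - q) = T i p - T i q"
  by (rule T_eqI) (auto simp: T_apply algebra_simps)

lemma T_cst [simp]: "i \<le> n \<Longrightarrow> T i (cst k) = cst (c i * k)"
  by (rule T_eqI) auto

lemma T_0 [simp]: "i \<le> n \<Longrightarrow> T i 0 = 0" and T_1 [simp]: "i \<le> n \<Longrightarrow> T i 1 = cst (c i)"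
  using T_cst[of i 0] T_cst[of i 1] by simp_all

section \<open>Relations between T and X\<close>

text \<open>Because \<open>s_i\<close> negates \<open>d_i\<close>, the terms with \<open>d_i\<close>
  cancel and only the square of \<open>chi_i\<close> survives.\<close>

lemma T_T_same [simp]: "p \<in> V \<Longrightarrow> i \<le> n \<Longrightarrow> T i (T i p) = cst ((c i)\<^sup>2) * p"
  by (rule T_eqI) (auto simp: T_apply algebra_simps power2_eq_square)

lemma T_crd_far:
  assumes "p \<in> V" "i \<le> n" "j \<in> {1..n}" "j \<noteq> i" "j \<noteq> i + 1"
  shows "T i (crd j * p) = crd j * T i p"
proof (rule T_eqI)
  have "s i x j = x j" for x using assms by (auto simp: refl_gen_def transpose_def)
  then show "(crd j * T i p) x = c i * (crd j * p) (s i x)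
    + d i x * ((crd j * p) (s i x) - (crd j * p) x)" if "a i x \<noteq> 0" for x
    using assms that by (auto simp: T_apply algebra_simps)
qed (use assms in auto)

lemma T_crd:
  assumes "p \<in> V" "i \<in> {1..<n}"
  shows "T i (crd (i+1) * p) = crd i * T i p + cst t * p"
proof (rule T_eqI)
  show "(crd i * T i p + cst t * p) x = c i * (crd (i+1) * p) (s i x)
    + d i x * ((crd (i+1) * p) (s i x) - (crd (i+1) * p) x)" if "a i x \<noteq> 0" for x
    using assms that by (auto simp: T_apply d_fun_def a_fun_def refl_gen_def field_simps)
qed (use assms in auto)

lemma T_crd':
  assumes "p \<in> V" "i \<in> {1..<n}"
  shows "T i (crd i * p) = crd (i+1) * T i p - cst t * p"
proof (rule T_eqI)
  show "(crd (i+1) * T i p - cst t * p) x = c i * (crd i * p) (s i x)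
    + d i x * ((crd i * p) (s i x) - (crd i * p) x)" if "a i x \<noteq> 0" for x
    using assms that by (auto simp: T_apply d_fun_def a_fun_def refl_gen_def field_simps)
qed (use assms in auto)

text \<open>Given \<open>T_n^2 = t_n^2\<close>, this is equivalent to
  \<open>(X_n + T_n)^2 = u_n^2\<close>, the form behind \<open>Uc_Uc\<close>.\<close>

lemma T_crd_n:
  assumes "p \<in> V"
  shows "T n (crd n * p) = - (crd n * T n p) - cst (tn\<^sup>2 - un\<^sup>2) * p - crd n * (crd n * p)"
proof (rule T_eqI)
  show "(- (crd n * T n p) - cst (tn\<^sup>2 - un\<^sup>2) * p - crd n * (crd n * p)) x = c n * (crd n * p) (s n x)
    + d n x * ((crd n * p) (s n x) - (crd n * p) x)" if "a n x \<noteq> 0" for x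
    using assms that n2
    by (auto simp: T_apply d_fun_def a_fun_def refl_gen_def field_simps power2_eq_square)
qed (use assms n2 in auto)

text \<open>Given \<open>T_0^2 = t_0^2\<close>, this is equivalent to
  \<open>(T_0 - X_1 + 1/2)^2 = u_0^2\<close>, the form behind \<open>Y_1_U\<close>.\<close>

lemma T_crd_0:
  assumes "p \<in> V"
  shows "T 0 (crd 1 * p) = - (crd 1 * T 0 p) + T 0 p + cst (t0\<^sup>2 + 1/4 - u0\<^sup>2) * p
     - crd 1 * p + crd 1 * (crd 1 * p)"
proof (rule T_eqI)
  show "(- (crd 1 * T 0 p) + T 0 p + cst (t0\<^sup>2 + 1/4 - u0\<^sup>2) * p
     - crd 1 * p + crd 1 * (crd 1 * p)) x = c 0 * (crd 1 * p) (s 0 x)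
    + d 0 x * ((crd 1 * p) (s 0 x) - (crd 1 * p) x)" if "a 0 x \<noteq> 0" for x
  proof -
    \<comment> \<open>The denominator is cleared once; afterwards \<open>d 0 x\<close> is treated as
      an atom in a polynomial identity.\<close>
    have key: "d 0 x * (1 - 2 * x 1) = t0\<^sup>2 - u0\<^sup>2 + (1/2 - x 1)\<^sup>2"
      using that by (simp add: d_fun_def a_fun_def)
    have "d 0 x * p x = 2 * (d 0 x * p x * x 1) + (t0\<^sup>2 - u0\<^sup>2 + (1/2 - x 1)\<^sup>2) * p x"
      unfolding key[symmetric] by (simp add: algebra_simps)
    moreover have s: "s 0 x (Suc 0) = 1 - x (Suc 0)" by (simp add: refl_gen_def)
    ultimately show ?thesis using assms that
      by (simp add: T_apply s algebra_simps power2_eq_square)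
  qed
qed (use assms n2 in auto)

section \<open>Commutation and braid relations of the \<open>T_i\<close>\<close>

lemma T_T_far:
  assumes "p \<in> V" "i \<le> n" "j \<le> n" "j + 2 \<le> i"
  shows "T i (T j p) = T j (T i p)"
proof -
  obtain y where y: "a i y \<noteq> 0" using a_nonzero by blast
  have s: "s i (s j x) = s j (s i x)" "a i (s j x) = a i x" "a j (s i x) = a j x"
     "num i (s j x) = num i x" "num j (s i x) = num j x" for x
    using assms n2
    by (auto simp: refl_gen_def a_fun_def num_def transpose_def fun_eq_iff)
  then have d: "d i (s j x) = d i x" "d j (s i x) = d j x" for x by (auto simp: d_eq)
  obtain z where z: "a j z \<noteq> 0" using a_nonzero by blast
  have "(a i * a j) w \<noteq> 0 \<Longrightarrow> T i (T j p) w = T j (T i p) w" for w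
    using assms by (auto simp: T_apply s d algebra_simps)
  \<comment> \<open>Neither factor vanishes identically, so neither does the product that serves as
    \<open>D\<close> in \<open>polys_eqI\<close>.\<close>
  moreover obtain w where "(a i * a j) w \<noteq> 0"
    using polys_no_zero_divisors[where p = "a i" and q = "a j", OF a_polys a_polys _ y] assms z by fastforce
  ultimately show ?thesis using assms
    by (intro polys_eqI[of "a i * a j" n]) auto
qed


text \<open>The reflections match by the braid relation in the group. The coefficients match because
  \<open>1/(a b) = (1/a + 1/b) / (a + b)\<close> for \<open>a = a_i(x)\<close> and
  \<open>b = a_j(x)\<close>.\<close>

lemma T_braid:
  assumes "p \<in> V" "i \<in> {1..<n}" "i + 1 < n"
  shows "T (i+1) (T i (T (i+1) p)) = T i (T (i+1) (T i p))"
proof -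
  define j where "j = i + 1"
  define r where "r x y = t / (x - y)" for x y :: complex
  \<comment> \<open>The third factor is \<open>a_i + a_j\<close>, the denominator of
    \<open>d_i(s_j x)\<close> and \<open>d_j(s_i x)\<close>.\<close>
  define D where "D = a i * (a j * (crd i - crd (i+2)))"
  define y :: point where "y k = of_nat k" for k
  have ij: "i \<le> n" "j \<le> n" "c i = 1" "c j = 1" using assms by (auto simp: j_def chi_def)
  have D: "D \<in> V" "D y \<noteq> 0" using assms by (auto simp: D_def j_def a_fun_def y_def)
  have "T j (T i (T j p)) = T i (T j (T i p))"
  proof (rule polys_eqI[OF D])
    fix x assume Dx: "D x \<noteq> 0"
    define e where "e = x i - x (i+2)"
    have nz: "a i x \<noteq> 0" "a j x \<noteq> 0" "e \<noteq> 0" using Dx by (auto simp: D_def e_def)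
    have aij: "a i (s j (s i z)) = a j z" "a j (s i (s j z)) = a i z" 
      "a i (s j x) = e" "a j (s i x) = e" for z
      using assms by (auto simp: a_fun_def refl_gen_def j_def e_def)
    have dij: "d i (s j (s i z)) = d j z" "d j (s i (s j z)) = d i z"
      "d i (s j x) = t / e" "d j (s i x) = t / e" for z
      using assms aij by (simp_all add: d_eq num_def j_def)
    have sw: "s j (s i (s j x)) = s i (s j (s i x))"
      using assms by (auto simp: refl_gen_def j_def fun_eq_iff transpose_def)
    have e: "e = a i x + a j x" using assms by (simp add: e_def a_fun_def j_def)
    have "d i x = t / a i x" "d j x = t / a j x"
      using assms by (simp_all add: d_eq num_def j_def)
    then have "d i x * d j x = t / e * (d i x + d j x)"
      using nz unfolding e by (simp add: field_simps)
    then show "T j (T i (T j p)) x = T i (T j (T i p)) x"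
      using assms(1) nz ij
      by (simp add: T_apply aij dij sw) algebra
  qed (use assms ij in auto)
  then show ?thesis by (simp add: j_def)
qed

text \<open>The rank-two input for \<open>Uc_T\<close>, where \<open>W\<close> appears as
  \<open>- Uc (n - 1)\<close>. The braid relation of length four matches the longest terms; the
  other coefficients reduce to the rational identities \<open>h1\<close> and
  \<open>h2\<close>.\<close>

lemma T_reflection_equation:
  assumes "p \<in> V" "m = n - 1"
  defines "W \<equiv> \<lambda>p. T m (crd n * T m p + T n (T m p))"
  shows "T n (W p) = W (T n p)"
proof -
  \<comment> \<open>Up to a constant, the last two factors are the denominators of
    \<open>d_n(s_m x)\<close> and \<open>d_m(s_n x)\<close>.\<close>
  define D where "D = a m * (a n * (crd m * (crd m + crd n)))"
  define y :: point where "y k = of_nat k" for k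
  have mn: "m \<le> n" "c m = 1" "c n = tn" "m \<noteq> 0" "m \<noteq> n" "Suc m = n"
    using assms n2 by (auto simp: chi_def)
  have D: "D \<in> V" "D y \<noteq> 0" using mn n2
    by (auto simp: D_def a_fun_def y_def of_nat_add[symmetric] simp del: of_nat_add)
  show ?thesis
  proof (rule polys_eqI[OF D])
    fix x assume Dx: "D x \<noteq> 0"
    define e where "e = x m + x n"
    have nz: "a m x \<noteq> 0" "a n x \<noteq> 0" "e \<noteq> 0" "x m \<noteq> 0" "x n \<noteq> 0"
      using Dx mn by (auto simp: D_def e_def a_fun_def)
    have aij: "a m (s n (s m z)) = a m (s n z)" "a n (s m (s n z)) = a n (s m z)" 
      "a m (s n x) = e" "a n (s m x) = 2 * x m" for z
      using mn by (auto simp: a_fun_def refl_gen_def e_def transpose_def)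
    have dij: "d m (s n (s m z)) = d m (s n z)" "d n (s m (s n z)) = d n (s m z)" for z
    proof -
      have "num m z = t" "num n (s m (s n z)) = num n (s m z)" for z
        using mn by (simp_all add: num_def refl_gen_def transpose_def)
      then show "d m (s n (s m z)) = d m (s n z)" "d n (s m (s n z)) = d n (s m z)"
        by (simp_all add: d_eq aij)
    qed
    have sw: "s m (s n (s m (s n x))) = s n (s m (s n (s m x)))"
      using mn by (auto simp: refl_gen_def fun_eq_iff transpose_def)
    have xn: "s m x n = x m" "s n z n = - z n" "s m (s n (s m x)) n = x n"
        "s m (s n x) n = x m" for z
      using mn by (auto simp: refl_gen_def fun_eq_iff transpose_def)
    define ea where "ea = d n (s m x)"
    define eb where "eb = d n x"
    define r where "r = d m x"
    define q where "q = d m (s n x)"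
    have r: "r = t / (x m - x n)" and q: "q = t / (x m + x n)"
      using mn by (simp_all add: r_def q_def d_eq num_def a_fun_def refl_gen_def)
    have ea: "ea = (tn\<^sup>2 - un\<^sup>2 + (x m)\<^sup>2) / (2 * x m)" and eb: "eb = (tn\<^sup>2 - un\<^sup>2 + (x n)\<^sup>2) / (2 * x n)"
      using mn by (simp_all add: ea_def eb_def d_fun_def xn)
    have nz': "x m - x n \<noteq> 0" "x m + x n \<noteq> 0" using nz mn by (auto simp: a_fun_def e_def)
    \<comment> \<open>Both sides equal \<open>t (k + A B) / (2 A B)\<close>. Since
      \<open>(k + z^2) / (2 z)\<close> is odd in \<open>z\<close>, replacing \<open>B\<close> by
      \<open>-B\<close> gives \<open>h2\<close> from the identity behind \<open>h1\<close>.\<close>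
    have *: "A - B \<noteq> 0 \<Longrightarrow> A + B \<noteq> 0 \<Longrightarrow> A \<noteq> 0 \<Longrightarrow> B \<noteq> 0 \<Longrightarrow>
        t / (A - B) * (A - B - ((k + A\<^sup>2) / (2 * A) - (k + B\<^sup>2) / (2 * B)))
        = t / (A + B) * ((k + A\<^sup>2) / (2 * A) + (k + B\<^sup>2) / (2 * B))"
      for A B k :: complex
    proof -
      assume nz: "A - B \<noteq> 0" "A + B \<noteq> 0" "A \<noteq> 0" "B \<noteq> 0"
      have "A - B - ((k + A\<^sup>2) / (2 * A) - (k + B\<^sup>2) / (2 * B)) = (A - B) * ((k + A * B) / (2 * A * B))"
        using nz by (simp add: field_simps power2_eq_square)
      moreover have "(k + A\<^sup>2) / (2 * A) + (k + B\<^sup>2) / (2 * B) = (A + B) * ((k + A * B) / (2 * A * B))"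
        using nz by (simp add: field_simps power2_eq_square)
      ultimately show ?thesis using nz by simp
    qed
    have crdn: "crd n \<in> V" using n2 by auto
    have h1: "r * (x m - x n - (ea - eb)) = q * (ea + eb)"
      unfolding r q ea eb by (rule *) (use nz nz' in auto)
    have h2: "q * (x m + x n - (ea + eb)) = r * (ea - eb)"
      using *[of "x m" "- x n" "tn\<^sup>2 - un\<^sup>2"] nz nz' unfolding r q ea eb by simp
    show "T n (W p) x = W (T n p) x"
      using assms(1) nz mn(1-3) h1 h2 crdn
      by (simp add: W_def T_apply aij dij sw xn ea_def[symmetric] eb_def[symmetric]
        r_def[symmetric] q_def[symmetric]) algebra
  qed (use assms mn in \<open>auto simp: W_def\<close>)
qed


section \<open>The operators U and Y\<close>

lemma c_eq_1 [simp]: "1 \<le> k \<Longrightarrow> k < n \<Longrightarrow> c k = 1"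
  by (simp add: chi_def)

lemma T_T_1 [simp]: "p \<in> V \<Longrightarrow> i \<in> {1..<n} \<Longrightarrow> T i (T i p) = p"
  by (simp add: chi_def)

abbreviation Tw where "Tw \<equiv> T_word n P"

lemma Tw_Nil [simp]: "Tw [] p = p"
  and Tw_Cons [simp]: "Tw (i # w) p = T i (Tw w p)"
  by (simp_all add: T_word_def word_comp_def)

lemma Tw_append [simp]: "Tw (v @ w) p = Tw v (Tw w p)"
  by (induction v) simp_all

lemma Tw_polys [simp]: "set w \<subseteq> {0..n} \<Longrightarrow> p \<in> V \<Longrightarrow> Tw w p \<in> V"
  by (induction w) simp_all

lemma Tw_add [simp]:
  "set w \<subseteq> {0..n} \<Longrightarrow> p \<in> V \<Longrightarrow> q \<in> V \<Longrightarrow> Tw w (p + q) = Tw w p + Tw w q"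
  by (induction w) simp_all

lemma Tw_cst_mult [simp]:
  "set w \<subseteq> {0..n} \<Longrightarrow> p \<in> V \<Longrightarrow> Tw w (cst k * p) = cst k * Tw w p"
  by (induction w) simp_all

lemma Tw_uminus [simp]: "set w \<subseteq> {0..n} \<Longrightarrow> p \<in> V \<Longrightarrow> Tw w (- p) = - Tw w p"
  by (induction w) simp_all

lemma Tw_diff [simp]:
  "set w \<subseteq> {0..n} \<Longrightarrow> p \<in> V \<Longrightarrow> q \<in> V \<Longrightarrow> Tw w (p - q) = Tw w p - Tw w q"
  by (induction w) simp_all

text \<open>
  \<open>Uc 1\<close> is \<open>U\<close>, and \<open>Y\<^sub>k = Dc k + Bc k\<close> with \<open>Bc k\<close> the summand containing \<open>T\<^sub>0\<close>. The indexed
  families satisfy one-step recursions under conjugation by \<open>T\<^sub>k\<close>, which reduces every relation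
  for \<open>U\<close> and \<open>Y\<close> to one for \<open>X\<^sub>n\<close>, \<open>T\<^sub>n\<close> or \<open>T\<^sub>0\<close>.
\<close>

definition Uc where
  "Uc k p = Tw [k..<n] (- (crd n * Tw (rev [k..<n]) p) - T n (Tw (rev [k..<n]) p))"

definition Dc where
  "Dc k p = Tw ([k..<n] @ [n] @ rev [k..<n]) p
     + cst t * (\<lambda>x. \<Sum>j=k+1..n. T_pair n P k j p x)"

definition Bc where "Bc k p = Tw (rev [1..<k] @ [0] @ [1..<k]) p"

lemma U_eq_Uc: "U p = Uc 1 p"
proof -
  have "(\<lambda>x. - X_op n q x - T n q x) = - (crd n * q) - T n q" for q
    by (simp add: fun_eq_iff X_op_def)
  then show ?thesis by (simp add: U_op_def Uc_def)
qed

lemma Y_eq: "Y i p = Dc i p + Bc i p"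
  by (simp add: Y_op_def Dc_def Bc_def fun_eq_iff)

lemma crd_n_polys [simp]: "crd n \<in> V" "crd (Suc 0) \<in> V"
  using n2 by auto

lemma Uc_n: "Uc n p = - (crd n * p) - T n p"
  by (simp add: Uc_def)

lemma Uc_step: "k < n \<Longrightarrow> Uc k p = T k (Uc (k+1) (T k p))"
  by (simp add: Uc_def upt_conv_Cons)

lemma Uc_polys [simp]: "p \<in> V \<Longrightarrow> Uc k p \<in> V"
  unfolding Uc_def by (intro Tw_polys diff_polys uminus_polys mult_polys T_polys) auto

lemma Uc_add [simp]:
  assumes "p \<in> V" "q \<in> V"
  shows "Uc k (p + q) = Uc k p + Uc k q"
proof -
  define w where "w = [k..<n]"
  have "set w \<subseteq> {0..n}" by (auto simp: w_def)
  then show ?thesis unfolding Uc_def w_def[symmetric] using assms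
    by (simp add: distrib_left)
qed

lemma Uc_cst_mult [simp]:
  assumes "p \<in> V"
  shows "Uc k (cst r * p) = cst r * Uc k p"
proof -
  define w where "w = [k..<n]"
  have "set w \<subseteq> {0..n}" by (auto simp: w_def)
  then show ?thesis unfolding Uc_def w_def[symmetric] using assms
    by (simp add: mult.left_commute[of "crd n"] right_diff_distrib)
qed

lemma Bc_1: "Bc (Suc 0) p = T 0 p"
  by (simp add: Bc_def)

lemma Bc_step: "1 \<le> k \<Longrightarrow> Bc (k+1) p = T k (Bc k (T k p))"
  by (simp add: Bc_def)

lemma Bc_polys [simp]: "p \<in> V \<Longrightarrow> k \<le> n \<Longrightarrow> Bc k p \<in> V"
  unfolding Bc_def by (intro Tw_polys) auto

lemma Bc_add [simp]:
    "p \<in> V \<Longrightarrow> q \<in> V \<Longrightarrow> k \<le> n \<Longrightarrow> Bc k (p + q) = Bc k p + Bc k q"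
  and Bc_cst_mult [simp]: "p \<in> V \<Longrightarrow> k \<le> n \<Longrightarrow> Bc k (cst r * p) = cst r * Bc k p"
  unfolding Bc_def by (rule Tw_add Tw_cst_mult; auto)+

lemma sum_polys: "(\<And>j. j \<in> A \<Longrightarrow> f j \<in> V) \<Longrightarrow> (\<lambda>x. \<Sum>j\<in>A. f j x) \<in> V"
  by (induction A rule: infinite_finite_induct) (auto intro: polys.intros)

lemma T_sum:
  "(\<And>j. j \<in> A \<Longrightarrow> f j \<in> V) \<Longrightarrow> i \<le> n \<Longrightarrow>
     T i (\<lambda>x. \<Sum>j\<in>A. f j x) = (\<lambda>x. \<Sum>j\<in>A. T i (f j) x)"
  by (rule T_eqI)
    (auto simp: T_apply sum_polys sum.distrib sum_distrib_left right_diff_distrib sum_subtractf)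

lemma T_pair_polys [simp]: "p \<in> V \<Longrightarrow> j \<le> n \<Longrightarrow> 1 \<le> j \<Longrightarrow> T_pair n P k j p \<in> V"
  unfolding T_pair_def by (intro Tw_polys) auto

lemma T_pair_Suc: "T_pair n P k (Suc k) p = T k p"
  by (simp add: T_pair_def)

lemma T_pair_step: "k + 1 < j \<Longrightarrow> T_pair n P k j p = T k (T_pair n P (k+1) j (T k p))"
  by (simp add: T_pair_def upt_conv_Cons)

lemma Dc_n: "Dc n p = T n p"
  by (simp add: Dc_def fun_eq_iff)

lemma Dc_polys [simp]: "p \<in> V \<Longrightarrow> Dc k p \<in> V"
  unfolding Dc_def by (intro Tw_polys add_polys mult_polys sum_polys cst_polys) auto

text \<open>The summand \<open>j = k + 1\<close> is \<open>T_k\<close> itself and gives the extra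
  term; conjugation by \<open>T_k\<close> carries all other summands from \<open>k + 1\<close> to
  \<open>k\<close>.\<close>

lemma Dc_step:
  assumes "p \<in> V" "k < n"
  shows "Dc k p = T k (Dc (k+1) (T k p)) + cst t * T k p"
proof -
  have "{k+1..n} = insert (k+1) {k+2..n}" using assms by auto
  then have "(\<Sum>j=k+1..n. T_pair n P k j p x)
     = T k p x + (\<Sum>j=k+2..n. T k (T_pair n P (k+1) j (T k p)) x)" for x
    by (simp add: T_pair_Suc T_pair_step)
  then have "(\<lambda>x. \<Sum>j=k+1..n. T_pair n P k j p x)
     = T k p + T k (\<lambda>x. \<Sum>j=k+2..n. T_pair n P (k+1) j (T k p) x)"
    using assms by (subst T_sum) (auto simp: fun_eq_iff)
  moreover have "Tw [Suc k..<n] (T n (Tw (rev [Suc k..<n]) (T k p))) \<in> V"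
    using assms by (intro T_polys Tw_polys) auto
  moreover have "(\<lambda>x. \<Sum>j=k+2..n. T_pair n P (k+1) j (T k p) x) \<in> V"
    using assms by (intro sum_polys T_pair_polys) auto
  ultimately show ?thesis
    using assms by (simp add: Dc_def upt_conv_Cons algebra_simps)
qed

text \<open>For \<open>k = n\<close> this is the formula for \<open>Uc n\<close>. In the conjugation
  by \<open>T_k\<close>, the term \<open>t T_k\<close> from
  \<open>T_k X_{k+1} T_k = X_k + t T_k\<close> is the one in \<open>Dc_step\<close>. The identity
  replaces the long sum in \<open>Y_k\<close> by \<open>- X_k - Uc k\<close>.\<close>

lemma crd_Uc_Dc:
  assumes "p \<in> V" "1 \<le> k" "k \<le> n"
  shows "crd k * p + Uc k p + Dc k p = 0"
  using assms(3,1,2)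
proof (induction k arbitrary: p rule: inc_induct)
  case base
  then show ?case by (simp add: Uc_n Dc_n)
next
  case (step k)
  let ?q = "T k p"
  have q: "?q \<in> V" using step by simp
  have "crd (k+1) * ?q + Uc (k+1) ?q + Dc (k+1) ?q = 0"
    unfolding Suc_eq_plus1[symmetric] by (rule step.IH) (use q step.prems in auto)
  then have "T k (crd (k+1) * ?q + Uc (k+1) ?q + Dc (k+1) ?q) = T k 0"
    by (rule arg_cong)
  also have "\<dots> = 0" using step by simp
  finally have "T k (crd (k+1) * ?q) + T k (Uc (k+1) ?q) + T k (Dc (k+1) ?q) = 0"
    using step.hyps step.prems q by simp
  moreover have "T k (crd (k+1) * ?q) = crd k * p + cst t * ?q"
    using step.hyps step.prems T_crd[OF q, of k] T_T_1[of p k] by simp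
  ultimately show "crd k * p + Uc k p + Dc k p = 0"
    using step.hyps step.prems by (simp add: Dc_step Uc_step algebra_simps)
qed

lemma Dc_eq: "p \<in> V \<Longrightarrow> 1 \<le> k \<Longrightarrow> k \<le> n \<Longrightarrow> Dc k p = - (crd k * p) - Uc k p"
  using crd_Uc_Dc[of p k] by (simp add: eq_diff_eq eq_neg_iff_add_eq_0 algebra_simps)

lemma Y_eq': "p \<in> V \<Longrightarrow> 1 \<le> i \<Longrightarrow> i \<le> n \<Longrightarrow> Y i p = Bc i p - crd i * p - Uc i p"
  by (simp add: Y_eq Dc_eq)

lemma Y_polys [simp]: "p \<in> V \<Longrightarrow> i \<le> n \<Longrightarrow> Y i p \<in> V"
  by (simp add: Y_eq)

lemma U_polys [simp]: "p \<in> V \<Longrightarrow> U p \<in> V"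
  by (simp add: U_eq_Uc)

lemma Y_add [simp]: "p \<in> V \<Longrightarrow> q \<in> V \<Longrightarrow> 1 \<le> i \<Longrightarrow> i \<le> n \<Longrightarrow> Y i (p + q) = Y i p + Y i q"
  by (simp add: Y_eq' algebra_simps)

lemma Y_cst_mult [simp]: "p \<in> V \<Longrightarrow> 1 \<le> i \<Longrightarrow> i \<le> n \<Longrightarrow> Y i (cst k * p) = cst k * Y i p"
  by (simp add: Y_eq' algebra_simps(16-) mult.left_commute[of "crd i"])


section \<open>Relations between T, U and Y\<close>

text \<open>Only \<open>X_n\<close> and \<open>T_k, ..., T_n\<close> occur in \<open>Uc k\<close>,
  and \<open>T_j\<close> commutes with each of them.\<close>

lemma Uc_T_below:
  assumes "p \<in> V" "k \<le> n" "j + 1 < k"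
  shows "Uc k (T j p) = T j (Uc k p)"
  using assms(2,1,3)
proof (induction k arbitrary: p rule: inc_induct)
  case base
  then have "T n (T j p) = T j (T n p)" by (intro T_T_far) auto
  then show "Uc n (T j p) = T j (Uc n p)" using base by (simp add: Uc_n T_crd_far)
next
  case (step k)
  have "Uc (Suc k) (T j q) = T j (Uc (Suc k) q)" if "q \<in> V" for q
    by (rule step.IH) (use that step.prems in auto)
  then show "Uc k (T j p) = T j (Uc k p)"
    using step.prems step.hyps T_T_far[of _ k j] by (simp add: Uc_step)
qed

lemma Bc_T_above:
  assumes "p \<in> V" "1 \<le> k" "k < j" "j \<le> n"
  shows "Bc k (T j p) = T j (Bc k p)"
  using assms(2,1,3,4)
proof (induction k arbitrary: p rule: nat_induct_at_least)
  case base
  then show "Bc 1 (T j p) = T j (Bc 1 p)" using T_T_far[of p j 0] by (simp add: Bc_1)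
next
  case (Suc k)
  have "Bc k (T j q) = T j (Bc k q)" if "q \<in> V" for q
    by (rule Suc.IH) (use that Suc.prems in auto)
  then show "Bc (Suc k) (T j p) = T j (Bc (Suc k) p)"
    using Suc.prems Suc.hyps Bc_step[of k] T_T_far[of _ j k, symmetric] by simp
qed

text \<open>Away from \<open>j = k + 1\<close> commuting generators suffice. For
  \<open>j = k + 1 < n\<close> the recursion is unrolled twice and the braid relation moves
  \<open>T_j\<close> through; for \<open>j = k + 1 = n\<close> the reflection equation does.\<close>

lemma Uc_T:
  assumes "p \<in> V" "k \<le> n" "1 \<le> k" "j \<le> n" "j \<noteq> k" "j + 1 \<noteq> k"
  shows "Uc k (T j p) = T j (Uc k p)"
  using assms(2,1,3-)
proof (induction k arbitrary: p j rule: inc_induct)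
  case base
  then have "T n (T j p) = T j (T n p)" by (intro T_T_far) auto
  then show "Uc n (T j p) = T j (Uc n p)" using base by (simp add: Uc_n T_crd_far)
next
  case (step k)
  have IH: "Uc (Suc k) (T i q) = T i (Uc (Suc k) q)" if "q \<in> V" "i \<le> n" "i \<noteq> k + 1" "i \<noteq> k" for q i
    by (rule step.IH) (use that in auto)
  show "Uc k (T j p) = T j (Uc k p)"
  proof (cases "j = k + 1")
    case False
    have com: "T k (T j q) = T j (T k q)" if "q \<in> V" for q
    proof (cases "j < k")
      case True
      then show ?thesis using that step.prems step.hyps by (intro T_T_far) auto
    next
      case False
      then show ?thesis using \<open>j \<noteq> k + 1\<close> that step.prems step.hyps
        by (intro T_T_far[symmetric]) auto
    qed
    show ?thesis using step.prems step.hyps False by (simp add: Uc_step com IH)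
  next
    case j: True
    show ?thesis
    proof (cases "j = n")
      case True
      then have k: "k = n - 1" "k < n" "Suc k = n" using j by auto
      define W where "W q = T k (crd n * T k q + T n (T k q))" for q
      have Uc: "Uc k q = - W q" if "q \<in> V" for q
        using that k(2) by (simp add: Uc_step k(3) Uc_n W_def)
      have "W p \<in> V" using step.prems k(2) by (simp add: W_def)
      moreover have "T n (W p) = W (T n p)"
        unfolding W_def by (rule T_reflection_equation) (use step.prems k in auto)
      ultimately show ?thesis using True step.prems by (simp add: Uc)
    next
      case False
      have br: "T j (T k (T j q)) = T k (T j (T k q))" if "q \<in> V" for q
        using T_braid[of q k] that j False step.prems step.hyps by simp
      have jn: "j < n" using False step.prems by simp
      have Ucj: "Uc (Suc j) (T k q) = T k (Uc (Suc j) q)" if "q \<in> V" for q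
          using that jn j by (intro Uc_T_below) auto
      have "Uc k q = T k (T j (Uc (j+1) (T j (T k q))))" if "q \<in> V" for q
        using step.hyps jn Uc_step j by simp
      then show ?thesis using step.prems step.hyps jn by (simp add: br Ucj)
    qed
  qed
qed

text \<open>The mirror image of \<open>Uc_T\<close>, with the recursion running upwards from
  \<open>T_0\<close>. In the step to \<open>Suc k\<close> the braid relation enters for
  \<open>j + 1 = k\<close>.\<close>

lemma Bc_T:
  assumes "p \<in> V" "1 \<le> k" "k \<le> n" "1 \<le> j" "j \<le> n" "j \<noteq> k" "j + 1 \<noteq> k"
  shows "Bc k (T j p) = T j (Bc k p)"
  using assms(2,1,3-)
proof (induction k arbitrary: p j rule: nat_induct_at_least)
  case base
  then show "Bc 1 (T j p) = T j (Bc 1 p)" using T_T_far[of p j 0] by (simp add: Bc_1)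
next
  case (Suc k)
  have IH: "Bc k (T i q) = T i (Bc k q)" if "q \<in> V" "1 \<le> i" "i \<le> n" "i \<noteq> k" "i + 1 \<noteq> k" for q i
    by (rule Suc.IH) (use that Suc.prems in auto)
  have Bk: "Bc (Suc k) q = T k (Bc k (T k q))" for q
    using Bc_step[of k] Suc.hyps by simp
  show "Bc (Suc k) (T j p) = T j (Bc (Suc k) p)"
  proof (cases "j + 1 = k")
    case False
    have com: "T k (T j q) = T j (T k q)" if "q \<in> V" for q
    proof (cases "j < k")
      case True
      then show ?thesis using that Suc.prems Suc.hyps False by (intro T_T_far) auto
    next
      case False
      then show ?thesis using that Suc.prems Suc.hyps
        by (intro T_T_far[symmetric]) auto
    qed
    show ?thesis
      using Suc.prems Suc.hyps False by (simp add: Bk com IH)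
  next
    case True
    have br: "T k (T j (T k q)) = T j (T k (T j q))" if "q \<in> V" for q
      using T_braid[of q j] that True Suc.prems Suc.hyps by simp
    have jk: "1 \<le> j" "j \<le> n" "k \<le> n" using True Suc.prems by auto
    have "Bc k q = T j (Bc j (T j q))" for q using Bc_step[of j] True Suc.prems by auto
    moreover have "Bc j (T k q) = T k (Bc j q)" if "q \<in> V" for q
        using that True Suc.prems by (intro Bc_T_above) auto
    ultimately show ?thesis using Suc.prems jk
      by (simp add: Bk br[symmetric])
  qed
qed


text \<open>The square of \<open>X_n + T_n\<close> is known from \<open>T_crd_n\<close>, and
  conjugation by the involutions \<open>T_k\<close> preserves it.\<close>

lemma Uc_Uc:
  assumes "p \<in> V" "k \<le> n" "1 \<le> k"
  shows "Uc k (Uc k p) = cst (un\<^sup>2) * p"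
  using assms(2,1,3)
proof (induction k arbitrary: p rule: inc_induct)
  case base
  have cn: "c n = tn" using n2 by (simp add: chi_def)
  show "Uc n (Uc n p) = cst (un\<^sup>2) * p"
    using base cn by (simp add: Uc_n T_crd_n) (simp add: fun_eq_iff algebra_simps)
next
  case (step k)
  have "Uc (Suc k) (Uc (Suc k) q) = cst (un\<^sup>2) * q" if "q \<in> V" for q
    by (rule step.IH) (use that in auto)
  then show "Uc k (Uc k p) = cst (un\<^sup>2) * p"
    using step.prems step.hyps by (simp add: Uc_step chi_def)
qed

lemma Bc_Bc:
  assumes "p \<in> V" "1 \<le> k" "k \<le> n"
  shows "Bc k (Bc k p) = cst (t0\<^sup>2) * p"
  using assms(2,1,3)
proof (induction k arbitrary: p rule: nat_induct_at_least)
  case base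
  then show "Bc 1 (Bc 1 p) = cst (t0\<^sup>2) * p" by (simp add: Bc_1 chi_def)
next
  case (Suc k)
  have "Bc k (Bc k q) = cst (t0\<^sup>2) * q" if "q \<in> V" for q
    by (rule Suc.IH) (use that Suc.prems in auto)
  then show "Bc (Suc k) (Bc (Suc k) p) = cst (t0\<^sup>2) * p"
    using Suc.prems Suc.hyps Bc_step[of k] by (simp add: chi_def)
qed

lemma U_add [simp]: "p \<in> V \<Longrightarrow> q \<in> V \<Longrightarrow> U (p + q) = U p + U q"
  and U_cst_mult [simp]: "p \<in> V \<Longrightarrow> U (cst r * p) = cst r * U p"
  by (simp_all add: U_eq_Uc)

lemma Y_1_eq: "p \<in> V \<Longrightarrow> Y (Suc 0) p = T 0 p - crd (Suc 0) * p - U p"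
  using Y_eq'[of p 1] n2 by (simp add: U_eq_Uc Bc_1)

lemma U_U: "p \<in> V \<Longrightarrow> U (U p) = cst (un\<^sup>2) * p"
  using Uc_Uc[of p 1] n2 by (simp add: U_eq_Uc)

text \<open>The mirror image of \<open>T_crd_0\<close> under \<open>X_1 -> -Y_1\<close>,
  \<open>T_0 -> U\<close> and the exchange of \<open>t_0\<close> and \<open>u_n\<close>.\<close>

lemma Y_1_U:
  assumes "p \<in> V"
  shows "Y 1 (U p) = - U (Y 1 p) + cst (u0\<^sup>2 - un\<^sup>2 - 1/4) * p - Y 1 p - Y 1 (Y 1 p) - U p"
proof -
  \<comment> \<open>Since \<open>T_0 - X_1 = Y_1 + U\<close>, the quadratic relation of the left
    side, expanded on the right with \<open>U^2 = u_n^2\<close>, is the claim.\<close>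
  define A where "A p = T 0 p - crd 1 * p" for p
  have A: "A q = Y 1 q + U q" if "q \<in> V" for q using Y_1_eq[OF that] by (simp add: A_def)
  have "A (A p) = cst (u0\<^sup>2 - 1/4) * p - A p"
    using assms T_crd_0[OF assms]
    by (simp add: A_def chi_def) (simp add: fun_eq_iff algebra_simps)
  then have *: "Y 1 (Y 1 p) + Y 1 (U p) + U (Y 1 p) + U (U p) = cst (u0\<^sup>2 - 1/4) * p - Y 1 p - U p"
    using assms n2 by (simp add: A algebra_simps)
  show ?thesis
  proof
    fix x
    show "Y 1 (U p) x = (- U (Y 1 p) + cst (u0\<^sup>2 - un\<^sup>2 - 1/4) * p - Y 1 p - Y 1 (Y 1 p) - U p) x"
      using fun_cong[OF *, of x] assms by (simp add: U_U algebra_simps eq_diff_eq)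
  qed
qed

lemma U_T: "p \<in> V \<Longrightarrow> 2 \<le> j \<Longrightarrow> j \<le> n \<Longrightarrow> U (T j p) = T j (U p)"
  unfolding U_eq_Uc by (rule Uc_T) auto

text \<open>For \<open>k = 2\<close> the two operators are the conjugates by \<open>T_1\<close> of
  \<open>Uc 2\<close> and \<open>T_0\<close>, which commute.\<close>

lemma U_Bc:
  assumes "p \<in> V" "2 \<le> k" "k \<le> n"
  shows "U (Bc k p) = Bc k (U p)"
  using assms(2,1,3)
proof (induction k arbitrary: p rule: nat_induct_at_least)
  case base
  have B: "Bc 2 q = T 1 (T 0 (T 1 q))" for q
    using Bc_step[of 1] by (simp add: Bc_1 numeral_2_eq_2)
  have U: "U q = T 1 (Uc 2 (T 1 q))" for q
    using Uc_step[of 1] n2 by (simp add: U_eq_Uc numeral_2_eq_2)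
  show "U (Bc 2 p) = Bc 2 (U p)"
    using base n2 by (simp add: U B Uc_T_below chi_def)
next
  case (Suc k)
  have "U (Bc k q) = Bc k (U q)" if "q \<in> V" for q
    by (rule Suc.IH) (use that Suc.prems in auto)
  then show "U (Bc (Suc k) p) = Bc (Suc k) (U p)"
    using Suc.prems Suc.hyps Bc_step[of k] U_T by simp
qed

lemma U_Dc:
  assumes "p \<in> V" "k \<le> n" "2 \<le> k"
  shows "U (Dc k p) = Dc k (U p)"
  using assms(2,1,3)
proof (induction k arbitrary: p rule: inc_induct)
  case base
  then show "U (Dc n p) = Dc n (U p)" by (simp add: Dc_n U_T)
next
  case (step k)
  have "U (Dc (Suc k) q) = Dc (Suc k) (U q)" if "q \<in> V" for q
    by (rule step.IH) (use that step.prems in auto)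
  then show "U (Dc k p) = Dc k (U p)"
    using step.prems step.hyps by (simp add: Dc_step U_T)
qed

lemma U_Y: "p \<in> V \<Longrightarrow> 2 \<le> i \<Longrightarrow> i \<le> n \<Longrightarrow> Y i (U p) = U (Y i p)"
  by (simp add: Y_eq U_Dc U_Bc)

section \<open>Cross relations of the \<open>T_j\<close> with the \<open>Y_i\<close>, mirroring
  those with the \<open>X_i\<close>\<close>

lemma Y_T_far:
  "p \<in> V \<Longrightarrow> 1 \<le> i \<Longrightarrow> i \<le> n \<Longrightarrow> 1 \<le> j \<Longrightarrow> j \<le> n \<Longrightarrow> j \<noteq> i \<Longrightarrow> j + 1 \<noteq> i \<Longrightarrow>
   Y i (T j p) = T j (Y i p)"
  by (simp add: Y_eq' Uc_T Bc_T T_crd_far)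

text \<open>Here \<open>Y_n = T_n + Bc n\<close>, and \<open>(Y_n - T_n)^2 = t_0^2\<close> mirrors
  \<open>(X_n + T_n)^2 = u_n^2\<close>.\<close>

lemma Y_n_T:
  assumes "p \<in> V"
  shows "Y n (T n p) = - T n (Y n p) + cst (tn\<^sup>2 - t0\<^sup>2) * p + Y n (Y n p)"
proof -
  have "c n = tn" using n2 by (simp add: chi_def)
  then show ?thesis using assms n2
    by (simp add: Y_eq Dc_n Bc_Bc) (simp add: fun_eq_iff algebra_simps)
qed

lemma Y_step:
  assumes "p \<in> V" "1 \<le> i" "i < n"
  shows "Y i p = T i (Y (i+1) (T i p)) + cst t * T i p"
  using assms Bc_step[of i] by (simp add: Y_eq Dc_step)

lemma Y_T:
  assumes "p \<in> V" "1 \<le> i" "i < n"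
  shows "Y i (T i p) = T i (Y (i+1) p) + cst t * p"
  using assms T_T_1[of p i] by (simp add: Y_step[of "T i p" i])

lemma Y_T':
  assumes "p \<in> V" "1 \<le> i" "i < n"
  shows "Y (i+1) (T i p) = T i (Y i p) - cst t * p"
  using assms T_T_1[of p i] T_T_1[of "Y (i+1) (T i p)" i] by (simp add: Y_step[of p i])

section \<open>Action of the \<open>Y_i\<close> on the constant 1\<close>

lemma Bc_one: "1 \<le> k \<Longrightarrow> k \<le> n \<Longrightarrow> Bc k 1 = cst t0"
proof (induction k rule: nat_induct_at_least)
  case base
  show "Bc 1 1 = cst t0" by (simp add: Bc_1 chi_def)
next
  case (Suc k)
  have "Bc k 1 = cst t0" by (rule Suc.IH) (use Suc.prems in auto)
  then show "Bc (Suc k) 1 = cst t0" using Suc.hyps Suc.prems Bc_step[of k] by simp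
qed

lemma Dc_one:
  assumes "k \<le> n" "1 \<le> k"
  shows "Dc k 1 = cst (tn + of_nat (n - k) * t)"
  using assms
proof (induction k rule: inc_induct)
  case base
  show "Dc n 1 = cst (tn + of_nat (n - n) * t)" using n2 by (simp add: Dc_n chi_def)
next
  case (step k)
  have "Dc (Suc k) 1 = cst (tn + of_nat (n - Suc k) * t)" by (rule step.IH) simp
  moreover have "n - k = Suc (n - Suc k)" using step.hyps by simp
  ultimately show "Dc k 1 = cst (tn + of_nat (n - k) * t)" using step.prems step.hyps
    by (simp add: Dc_step) (simp add: fun_eq_iff algebra_simps)
qed

lemma Y_one: "1 \<le> i \<Longrightarrow> i \<le> n \<Longrightarrow> Y i 1 = cst (gamma0 n P i)"
  by (simp add: Y_eq Dc_one Bc_one) (simp add: gamma0_def fun_eq_iff)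

section \<open>Evaluation at the point \<open>- x0\<close>\<close>

abbreviation x0 where "x0 \<equiv> gamma0 n (sigma P)"

lemma x0_eq: "1 \<le> i \<Longrightarrow> i \<le> n \<Longrightarrow> x0 i = un + tn + of_nat (n - i) * t"
  by (cases P) (simp add: gamma0_def)

text \<open>Off the hyperplane \<open>d_i\<close> equals \<open>- chi_i\<close> at this point, so
  the reflected value cancels. If the point lies on the hyperplane, it is fixed by
  \<open>s_i\<close>, and the parameters degenerate so that \<open>d_i\<close> has no pole.\<close>

lemma T_at_x0:
  assumes "p \<in> V" "1 \<le> i" "i \<le> n"
  shows "T i p (- x0) = c i * p (- x0)"
proof (cases "a i (- x0) = 0")
  case False
  have "d i (- x0) = - c i"
  proof (cases "i = n")
    case True
    have "tn + un \<noteq> 0" using False True n2 by (auto simp: a_fun_def x0_eq add_eq_0_iff)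
    moreover define z where "z = tn + un"
    ultimately have z: "z \<noteq> 0" by simp
    have "tn\<^sup>2 - un\<^sup>2 + z\<^sup>2 = tn * (2 * z)"
      by (simp add: z_def power2_eq_square algebra_simps)
    moreover have "x0 n = z" using n2 by (simp add: x0_eq z_def)
    ultimately have "d n (- x0) = tn * (2 * z) / (2 * - z)"
      using n2 by (simp add: d_fun_def)
    then show ?thesis using True n2 z by (simp add: chi_def)
  next
    case i: False
    then have "n - i = Suc (n - Suc i)" using assms by simp
    then have "a i (- x0) = - t" using assms i by (simp add: a_fun_def x0_eq algebra_simps)
    then show ?thesis using i assms False by (simp add: d_eq chi_def num_def)
  qed
  then show ?thesis using False assms by (simp add: T_apply algebra_simps)
next
  case True
  then have s: "s i (- x0) = - x0" using assms by (intro s_fix) auto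
  show ?thesis
  proof (cases "i = n")
    case i: True
    have "x0 n = 0" using True i n2 by (simp add: a_fun_def)
    then have "un + tn = 0" using x0_eq[of n] n2 by simp
    then have un: "un = - tn" by (rule add_eq_0_iff2[THEN iffD1])
    \<comment> \<open>With \<open>u_n = - t_n\<close> the numerator of \<open>d_n\<close> is
      \<open>x_n^2\<close>, so \<open>d_n = x_n / 2\<close>, which vanishes at the point.\<close>
    have "T i p = cst tn * (\<lambda>x. p (s i x)) + cst (1/2) * crd n * ((\<lambda>x. p (s i x)) - p)"
      unfolding i
    proof (rule T_eqI)
      fix x assume "a n x \<noteq> 0"
      then have "d n x = x n / 2" using n2 un by (simp add: d_fun_def a_fun_def power2_eq_square)
      then show "(cst tn * (\<lambda>x. p (s n x)) + cst (1/2) * crd n * ((\<lambda>x. p (s n x)) - p)) x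
          = c n * p (s n x) + d n x * (p (s n x) - p x)"
        using n2 by (simp add: chi_def)
    qed (use assms s_polys[OF assms(1), of n] in auto)
    then show ?thesis using s i n2 by (simp add: chi_def)
  next
    case False
    then have "n - i = Suc (n - Suc i)" using assms by simp
    then have "t = 0" using True assms False by (simp add: a_fun_def x0_eq algebra_simps)
    then have "T i p = (\<lambda>x. p (s i x))"
      using assms False s_polys[OF assms(1), of i] by (intro T_eqI) (auto simp: chi_def d_fun_def)
    then show ?thesis using s False assms by (simp add: chi_def)
  qed
qed

text \<open>The middle factor \<open>- X_n - T_n\<close> contributes
  \<open>x0 n - t_n = u_n\<close>, and the surrounding \<open>T_k\<close> act by 1.\<close>

lemma Uc_at_x0:
  assumes "p \<in> V" "k \<le> n" "1 \<le> k"
  shows "Uc k p (- x0) = un * p (- x0)"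
  using assms(2,1,3)
proof (induction k arbitrary: p rule: inc_induct)
  case base
  then show "Uc n p (- x0) = un * p (- x0)"
    using n2 by (simp add: Uc_n T_at_x0 x0_eq chi_def algebra_simps)
next
  case (step k)
  have "Uc (Suc k) q (- x0) = un * q (- x0)" if "q \<in> V" for q
    by (rule step.IH) (use that in auto)
  then show "Uc k p (- x0) = un * p (- x0)"
    using step.prems step.hyps by (simp add: Uc_step T_at_x0)
qed

lemma U_at_x0: "p \<in> V \<Longrightarrow> U p (- x0) = un * p (- x0)"
  using Uc_at_x0[of p 1] n2 by (simp add: U_eq_Uc)


section \<open>The pairing\<close>

text \<open>
  \<open>rep f l\<close> says that \<open>l\<close> is the functional \<open>{f, \<cdot>}\<close> on polynomials. As a relation it needs
  neither the commutativity of the \<open>Y\<^sub>i\<close> nor a unique presentation of \<open>f\<close>; that \<open>l\<close> is determined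
  by \<open>f\<close> on polynomials follows from the symmetry of the pairing.
\<close>

inductive rep :: "pfun \<Rightarrow> (pfun \<Rightarrow> complex) \<Rightarrow> bool" where
  const: "rep (cst k) (\<lambda>g. k * g (- x0))"
| crd: "rep f l \<Longrightarrow> 1 \<le> i \<Longrightarrow> i \<le> n \<Longrightarrow> rep (crd i * f) (\<lambda>g. - l (Y i g))"
| add: "rep f l \<Longrightarrow> rep f' l' \<Longrightarrow> rep (f + f') (\<lambda>g. l g + l' g)"
| eq_on: "rep f l \<Longrightarrow> (\<And>g. g \<in> V \<Longrightarrow> l g = l' g) \<Longrightarrow> rep f l'"

lemma rep_induct [consumes 1, case_names const crd add eq_on]:
  assumes "rep f l"
    and "\<And>k. Q (cst k) (\<lambda>g. k * g (- x0))"
    and "\<And>f l i. rep f l \<Longrightarrow> Q f l \<Longrightarrow> 1 \<le> i \<Longrightarrow> i \<le> n \<Longrightarrow> Q (crd i * f) (\<lambda>g. - l (Y i g))"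
    and "\<And>f l f' l'. rep f l \<Longrightarrow> Q f l \<Longrightarrow> rep f' l' \<Longrightarrow> Q f' l' \<Longrightarrow> Q (f + f') (\<lambda>g. l g + l' g)"
    and "\<And>f l l'. rep f l \<Longrightarrow> Q f l \<Longrightarrow> (\<And>g. g \<in> V \<Longrightarrow> l g = l' g) \<Longrightarrow> Q f l'"
  shows "Q f l"
  using assms(1) by (rule rep.induct) (rule assms; assumption)+

lemma rep_polys: "rep f l \<Longrightarrow> f \<in> V"
  by (erule rep_induct[where Q = "\<lambda>f l. f \<in> V"]) auto

lemma rep_add_arg: "rep f l \<Longrightarrow> g \<in> V \<Longrightarrow> h \<in> V \<Longrightarrow> l (g + h) = l g + l h"
  by (rule rep_induct[where Q = "\<lambda>f l. \<forall>g\<in>V. \<forall>h\<in>V. l (g + h) = l g + l h", THEN bspec, THEN bspec])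
    (auto simp: algebra_simps)

lemma rep_cst_mult_arg: "rep f l \<Longrightarrow> g \<in> V \<Longrightarrow> l (cst k * g) = k * l g"
  by (rule rep_induct[where Q = "\<lambda>f l. \<forall>g\<in>V. l (cst k * g) = k * l g", THEN bspec])
    (auto simp: distrib_left)

lemma rep_uminus_arg: "rep f l \<Longrightarrow> g \<in> V \<Longrightarrow> l (- g) = - l g"
proof -
  assume "rep f l" "g \<in> V"
  moreover have "- g = cst (-1) * g" by (simp add: fun_eq_iff)
  ultimately show ?thesis using rep_cst_mult_arg[of f l g "-1"] by simp
qed

lemma rep_diff_arg: "rep f l \<Longrightarrow> g \<in> V \<Longrightarrow> h \<in> V \<Longrightarrow> l (g - h) = l g - l h"
  using rep_add_arg[of f l g "- h"] rep_uminus_arg[of f l h] by simp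

lemmas rep_arg = rep_add_arg rep_cst_mult_arg rep_uminus_arg rep_diff_arg

lemma rep_cst_mult: "rep f l \<Longrightarrow> rep (cst k * f) (\<lambda>g. k * l g)"
proof (induction rule: rep_induct)
  case (const r)
  have "cst k * cst r = cst (k * r)" by (simp add: fun_eq_iff)
  then show "rep (cst k * cst r) (\<lambda>g. k * (r * g (- x0)))"
    using rep.const[of "k * r"] by (simp add: mult.assoc)
next
  case (crd f l i)
  have "rep (crd i * (cst k * f)) (\<lambda>g. - (k * l (Y i g)))"
    by (rule rep.crd[OF crd.IH]) (use crd.hyps in auto)
  then show "rep (cst k * (crd i * f)) (\<lambda>g. k * - l (Y i g))"
    by (simp add: mult.left_commute)
next
  case (add f l f' l')
  have "rep (cst k * f + cst k * f') (\<lambda>g. k * l g + k * l' g)" by (rule rep.add[OF add.IH])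
  then show "rep (cst k * (f + f')) (\<lambda>g. k * (l g + l' g))" by (simp only: distrib_left)
next
  case (eq_on f l l')
  show ?case by (rule rep.eq_on[OF eq_on.IH]) (use eq_on in auto)
qed

lemma rep_uminus: "rep f l \<Longrightarrow> rep (- f) (\<lambda>g. - l g)"
proof -
  assume "rep f l"
  moreover have "- f = cst (-1) * f" by (simp add: fun_eq_iff)
  ultimately show ?thesis using rep_cst_mult[of f l "-1"] by simp
qed

lemma rep_diff: "rep f l \<Longrightarrow> rep f' l' \<Longrightarrow> rep (f - f') (\<lambda>g. l g - l' g)"
  using rep.add[of f l "- f'" "\<lambda>g. - l' g"] rep_uminus[of f' l'] by simp

lemma rep_ex:
  assumes "f \<in> V"
  shows "\<exists>l. rep f l"
proof -
  \<comment> \<open>Multiplying onto an arbitrary represented \<open>g\<close> lets the product case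
    compose two multiplications; \<open>g = 1\<close> gives the claim.\<close>
  have "\<exists>l. rep (f * g) l" if "rep g l" for g l
    using assms that
  proof (induction arbitrary: g l)
    case (const k)
    then have "rep ((\<lambda>x. k) * g) (\<lambda>h. k * l h)" using rep_cst_mult[of g l k] by (simp add: cst_def)
    then show "\<exists>l. rep ((\<lambda>x. k) * g) l" by blast
  next
    case (coord i)
    then have "rep ((\<lambda>x. x i) * g) (\<lambda>h. - l (Y i h))" using rep.crd[of g l i] by (simp add: crd_def)
    then show "\<exists>l. rep ((\<lambda>x. x i) * g) l" by blast
  next
    case (add p q)
    then obtain l1 l2 where "rep (p * g) l1" "rep (q * g) l2" by blast
    then have "rep (p * g + q * g) (\<lambda>h. l1 h + l2 h)" by (rule rep.add)
    moreover have "p * g + q * g = (\<lambda>x. p x + q x) * g" by (simp add: fun_eq_iff algebra_simps)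
    ultimately have "rep ((\<lambda>x. p x + q x) * g) (\<lambda>h. l1 h + l2 h)" by simp
    then show "\<exists>l. rep ((\<lambda>x. p x + q x) * g) l" by blast
  next
    case (mult p q)
    then obtain l2 where "rep (p * (q * g)) l2" by blast
    moreover have "p * (q * g) = (\<lambda>x. p x * q x) * g" by (simp add: fun_eq_iff)
    ultimately have "rep ((\<lambda>x. p x * q x) * g) l2" by simp
    then show "\<exists>l. rep ((\<lambda>x. p x * q x) * g) l" by blast
  qed
  from this[OF rep.const[of 1]] show ?thesis by simp
qed

text \<open>On a joint eigenvector every \<open>- Y_i\<close> is the scalar \<open>- g i\<close>, so
  \<open>f(-Y)\<close> is the scalar \<open>f (- g)\<close>.\<close>

lemma rep_eigen:
  assumes "rep f l" "v \<in> V" "\<And>i. 1 \<le> i \<Longrightarrow> i \<le> n \<Longrightarrow> Y i v = cst (g i) * v"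
  shows "l v = f (- g) * v (- x0)"
  using assms(1)
proof (induction rule: rep_induct)
  case (crd f l i)
  have "l v = f (- g) * v (- x0)" by (rule crd.IH)
  then have "l (cst (g i) * v) = g i * (f (- g) * v (- x0))"
    using assms(2) rep_cst_mult_arg[OF crd.hyps(1)] by simp
  then show "- l (Y i v) = (crd i * f) (- g) * v (- x0)" using assms(3) crd.hyps by simp
next
  case (add f l f' l')
  have "l v = f (- g) * v (- x0)" "l' v = f' (- g) * v (- x0)" by (rule add.IH)+
  then show "l v + l' v = (f + f') (- g) * v (- x0)" by (simp add: algebra_simps)
next
  case (eq_on f l l')
  have "l v = f (- g) * v (- x0)" by (rule eq_on.IH)
  then show "l' v = f (- g) * v (- x0)" using assms(2) eq_on.hyps by simp
qed simp

lemma rep_one: "rep f l \<Longrightarrow> l 1 = f (- gamma0 n P)"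
  using rep_eigen[of f l 1 "gamma0 n P"] by (simp add: Y_one)

end

section \<open>Adjoints of \<open>T_i\<close>, \<open>U\<close> and \<open>X_k\<close> under the
  pairing\<close>

lemma par_sigma [simp]: "par_t0 (sigma P) = par_un P" "par_u0 (sigma P) = par_u0 P"
  "par_t (sigma P) = par_t P" "par_tn (sigma P) = par_tn P" "par_un (sigma P) = par_t0 P"
  "sigma (sigma P) = P"
  by (cases P; simp)+

context wilson_ops
begin

interpretation dual: wilson_ops n "sigma P"
  by unfold_locales (rule n2)

text \<open>Constants are handled by \<open>T_at_x0\<close>. For a new coordinate, moving the dual
  \<open>T_i\<close> past \<open>X_j\<close> obeys the same rule as moving \<open>T_i\<close> past
  \<open>- Y_j\<close>; the four cases are the four forms of that rule.\<close>

lemma rep_T: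
  assumes "rep f l" "1 \<le> i" "i \<le> n"
  shows "rep (dual.T i f) (\<lambda>g. l (T i g))"
  using assms(1)
proof (induction rule: rep_induct)
  case (const k)
  have "rep (cst (c i * k)) (\<lambda>g. c i * k * g (- x0))" by (rule rep.const)
  then have "rep (cst (c i * k)) (\<lambda>g. k * T i g (- x0))"
    by (rule rep.eq_on) (use assms in \<open>simp add: T_at_x0\<close>)
  moreover have "dual.c i = c i" using assms by (simp add: chi_def)
  ultimately show "rep (dual.T i (cst k)) (\<lambda>g. k * T i g (- x0))" using assms by simp
next
  case (crd f l j)
  have f: "f \<in> V" using crd rep_polys by blast
  have X: "rep (crd j * dual.T i f) (\<lambda>g. - l (T i (Y j g)))" if "1 \<le> j" "j \<le> n" for j
    using rep.crd[OF crd.IH that] .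
  consider "j = i" "i = n" | "j = i" "i < n" | "j = i + 1" | "j \<noteq> i" "j \<noteq> i + 1"
    using assms by linarith
  then show "rep (dual.T i (crd j * f)) (\<lambda>g. - l (Y j (T i g)))"
  proof cases
    case 1
    have XX: "rep (crd n * (crd n * f)) (\<lambda>g. - (- l (Y n (Y n g))))"
      using n2 by (intro rep.crd crd.hyps(1)) auto
    have "rep (- (crd n * dual.T n f) - cst (tn\<^sup>2 - t0\<^sup>2) * f - crd n * (crd n * f))
      (\<lambda>g. - (- l (T n (Y n g))) - (tn\<^sup>2 - t0\<^sup>2) * l g - (- (- l (Y n (Y n g)))))"
      using X[of n] 1 n2 by (intro rep_diff rep_uminus rep_cst_mult XX crd.hyps(1)) auto
    then have "rep (- (crd n * dual.T n f) - cst (tn\<^sup>2 - t0\<^sup>2) * f - crd n * (crd n * f))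
      (\<lambda>g. - l (Y n (T n g)))"
      by (rule rep.eq_on) (use crd n2 in \<open>simp add: Y_n_T rep_arg\<close>)
    then show ?thesis using 1 f by (simp add: dual.T_crd_n)
  next
    case 2
    have "rep (crd (i+1) * dual.T i f - cst t * f) (\<lambda>g. - l (T i (Y (i+1) g)) - t * l g)"
      using X[of "i+1"] 2 crd.hyps by (intro rep_diff rep_cst_mult) auto
    then have "rep (crd (i+1) * dual.T i f - cst t * f) (\<lambda>g. - l (Y i (T i g)))"
      by (rule rep.eq_on) (use crd 2 assms in \<open>simp add: Y_T rep_arg\<close>)
    then show ?thesis using 2 f assms dual.T_crd'[of f i] by simp
  next
    case 3
    have "rep (crd i * dual.T i f + cst t * f) (\<lambda>g. - l (T i (Y i g)) + t * l g)"
      using X[of i] 3 crd.hyps assms by (intro rep.add rep_cst_mult) auto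
    then have "rep (crd i * dual.T i f + cst t * f) (\<lambda>g. - l (Y j (T i g)))"
      by (rule rep.eq_on) (use crd 3 assms Y_T'[of _ i] in \<open>simp add: rep_arg\<close>)
    then show ?thesis using 3 f crd.hyps assms dual.T_crd[of f i] by simp
  next
    case 4
    have "rep (crd j * dual.T i f) (\<lambda>g. - l (Y j (T i g)))"
      by (rule rep.eq_on[OF X]) (use crd 4 assms in \<open>simp_all add: Y_T_far\<close>)
    then show ?thesis using 4 f crd.hyps assms by (simp add: dual.T_crd_far)
  qed
next
  case (add f l f' l')
  have "rep (dual.T i f + dual.T i f') (\<lambda>g. l (T i g) + l' (T i g))" by (rule rep.add[OF add.IH])
  moreover have "f \<in> V" "f' \<in> V" using add.hyps rep_polys by auto
  ultimately show "rep (dual.T i (f + f')) (\<lambda>g. l (T i g) + l' (T i g))" using assms by simp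
next
  case (eq_on f l l')
  show ?case by (rule rep.eq_on[OF eq_on.IH]) (use eq_on assms in auto)
qed

text \<open>As for \<open>rep_T\<close>: \<open>U\<close> has the value \<open>u_n\<close>, the dual
  \<open>chi_0\<close>, at \<open>- x0\<close>, and \<open>Y_1_U\<close> and \<open>U_Y\<close> are
  the counterparts of the dual \<open>T_crd_0\<close> and \<open>T_crd_far\<close>.\<close>

lemma rep_U:
  assumes "rep f l"
  shows "rep (dual.T 0 f) (\<lambda>g. l (U g))"
  using assms(1)
proof (induction rule: rep_induct)
  case (const k)
  have "rep (cst (un * k)) (\<lambda>g. un * k * g (- x0))" by (rule rep.const)
  then have "rep (cst (un * k)) (\<lambda>g. k * U g (- x0))"
    by (rule rep.eq_on) (simp add: U_at_x0)
  moreover have "dual.c 0 = un" by (simp add: chi_def)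
  ultimately show "rep (dual.T 0 (cst k)) (\<lambda>g. k * U g (- x0))" by simp
next
  case (crd f l j)
  have f: "f \<in> V" using crd rep_polys by blast
  have X: "rep (crd j * dual.T 0 f) (\<lambda>g. - l (U (Y j g)))" if "1 \<le> j" "j \<le> n" for j
    using rep.crd[OF crd.IH that] .
  show "rep (dual.T 0 (crd j * f)) (\<lambda>g. - l (Y j (U g)))"
  proof (cases "j = 1")
    case True
    have "rep (- (crd 1 * dual.T 0 f) + dual.T 0 f + cst (un\<^sup>2 + 1/4 - u0\<^sup>2) * f - crd 1 * f
        + crd 1 * (crd 1 * f))
      (\<lambda>g. - (- l (U (Y 1 g))) + l (U g) + (un\<^sup>2 + 1/4 - u0\<^sup>2) * l g - (- l (Y 1 g))
        + (- (- l (Y 1 (Y 1 g)))))"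
      using X[of 1] crd.IH crd.hyps n2
      by (intro rep_diff rep.add rep_uminus rep_cst_mult rep.crd) auto
    then have "rep (- (crd 1 * dual.T 0 f) + dual.T 0 f + cst (un\<^sup>2 + 1/4 - u0\<^sup>2) * f - crd 1 * f
        + crd 1 * (crd 1 * f)) (\<lambda>g. - l (Y 1 (U g)))"
      by (rule rep.eq_on)
        (use crd n2 in \<open>simp add: Y_1_U[simplified] rep_arg\<close>, simp add: algebra_simps)
    then show ?thesis using True f dual.T_crd_0[of f] by simp
  next
    case False
    have "rep (crd j * dual.T 0 f) (\<lambda>g. - l (Y j (U g)))"
      by (rule rep.eq_on[OF X]) (use crd False in \<open>simp_all add: U_Y\<close>)
    then show ?thesis using False f crd.hyps by (simp add: dual.T_crd_far)
  qed
next
  case (add f l f' l')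
  have "rep (dual.T 0 f + dual.T 0 f') (\<lambda>g. l (U g) + l' (U g))" by (rule rep.add[OF add.IH])
  moreover have "f \<in> V" "f' \<in> V" using add.hyps rep_polys by auto
  ultimately show "rep (dual.T 0 (f + f')) (\<lambda>g. l (U g) + l' (U g))" by simp
next
  case (eq_on f l l')
  show ?case by (rule rep.eq_on[OF eq_on.IH]) (use eq_on in auto)
qed


text \<open>
  Reading the chain \<open>U = T\<^sub>1 \<cdots> T\<^sub>n\<^sub>-\<^sub>1 (- X\<^sub>n - T\<^sub>n) T\<^sub>n\<^sub>-\<^sub>1 \<cdots> T\<^sub>1\<close> backwards expresses \<open>X\<^sub>n\<close> by \<open>U\<close>.
\<close>

lemma crd_n_eq:
  assumes "p \<in> V"
  shows "crd n * p = - T n p - Tw (rev [1..<n]) (U (Tw [1..<n] p))"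
proof -
  \<comment> \<open>Each letter squares to 1, so the reversed word is the inverse.\<close>
  have inv: "Tw (rev w) (Tw w q) = q" if "set w \<subseteq> {1..<n}" "q \<in> V" for w q
    using that
  proof (induction w arbitrary: q)
    case (Cons i w)
    have "Tw (rev w) (Tw w q) = q" by (rule Cons.IH) (use Cons.prems in auto)
    moreover have "set w \<subseteq> {0..n}" using Cons.prems by auto
    then have "T i (T i (Tw w q)) = Tw w q" using Cons.prems by (intro T_T_1) auto
    ultimately show "Tw (rev (i # w)) (Tw (i # w) q) = q" by simp
  qed simp
  have w: "set [1..<n] \<subseteq> {1..<n}" "set (rev [1..<n]) \<subseteq> {1..<n}" by auto
  have q: "- (crd n * p) - T n p \<in> V" using assms by simp
  have "Tw (rev [1..<n]) (Tw [1..<n] p) = p" by (rule inv[OF w(1) assms])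
  then have "U (Tw [1..<n] p) = Tw [1..<n] (- (crd n * p) - T n p)"
    by (simp add: U_eq_Uc Uc_def)
  then have "Tw (rev [1..<n]) (U (Tw [1..<n] p)) = - (crd n * p) - T n p"
    using inv[OF w(1) q] by simp
  then show ?thesis by simp
qed

text \<open>Each further adjoint enters at the innermost position of the argument, which reverses
  the word.\<close>

lemma rep_Tw:
  assumes "set w \<subseteq> {1..n}" "rep f l"
  shows "rep (dual.Tw w f) (\<lambda>g. l (Tw (rev w) g))"
  using assms
proof (induction w)
  case (Cons i w)
  have "rep (dual.Tw w f) (\<lambda>g. l (Tw (rev w) g))"
    by (rule Cons.IH) (use Cons.prems in auto)
  then have "rep (dual.T i (dual.Tw w f)) (\<lambda>g. l (Tw (rev w) (T i g)))"
    by (rule rep_T) (use Cons.prems in auto)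
  then show "rep (dual.Tw (i # w) f) (\<lambda>g. l (Tw (rev (i # w)) g))" by simp
qed simp

text \<open>For \<open>k = n\<close>, \<open>crd_n_eq\<close> writes \<open>X_n\<close> through
  \<open>T_n\<close> and \<open>U\<close>, whose adjoints assemble to the dual
  \<open>- T_n - Bc n\<close>. The step compares \<open>X_k = T_k X_{k+1} T_k - t T_k\<close> with
  \<open>- Y_k = T_k (- Y_{k+1}) T_k - t T_k\<close>.\<close>

lemma rep_Y:
  assumes "rep f l" "k \<le> n" "1 \<le> k"
  shows "rep (- dual.Y k f) (\<lambda>g. l (crd k * g))"
  using assms(2,1,3)
proof (induction k arbitrary: f l rule: inc_induct)
  case base
  have f: "f \<in> V" using base rep_polys by blast
  have "rep (dual.Tw [1..<n] f) (\<lambda>g. l (Tw (rev [1..<n]) g))"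
    by (rule rep_Tw) (use base in auto)
  then have "rep (dual.T 0 (dual.Tw [1..<n] f)) (\<lambda>g. l (Tw (rev [1..<n]) (U g)))"
    by (rule rep_U)
  then have "rep (dual.Tw (rev [1..<n]) (dual.T 0 (dual.Tw [1..<n] f)))
      (\<lambda>g. l (Tw (rev [1..<n]) (U (Tw (rev (rev [1..<n])) g))))"
    by (rule rep_Tw[rotated]) auto
  then have "rep (dual.Bc n f) (\<lambda>g. l (Tw (rev [1..<n]) (U (Tw [1..<n] g))))"
    by (simp add: dual.Bc_def)
  moreover have "rep (- dual.T n f) (\<lambda>g. - l (T n g))"
    using rep_uminus[OF rep_T[OF base(1), of n]] n2 by simp
  ultimately have "rep (- dual.T n f - dual.Bc n f)
      (\<lambda>g. - l (T n g) - l (Tw (rev [1..<n]) (U (Tw [1..<n] g))))"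
    by (rule rep_diff[rotated])
  moreover have "- dual.T n f - dual.Bc n f = - dual.Y n f"
    by (simp add: dual.Y_eq dual.Dc_n)
  ultimately have "rep (- dual.Y n f)
      (\<lambda>g. - l (T n g) - l (Tw (rev [1..<n]) (U (Tw [1..<n] g))))" by simp
  then show "rep (- dual.Y n f) (\<lambda>g. l (crd n * g))"
  proof (rule rep.eq_on)
    fix g assume g: "g \<in> V"
    have "Tw (rev [1..<n]) (U (Tw [1..<n] g)) \<in> V"
      using g by (intro Tw_polys U_polys) auto
    then have "l (- T n g - Tw (rev [1..<n]) (U (Tw [1..<n] g)))
        = l (- T n g) - l (Tw (rev [1..<n]) (U (Tw [1..<n] g)))"
      using g by (intro rep_diff_arg[OF base(1)]) auto
    moreover have "l (- T n g) = - l (T n g)" using g by (intro rep_uminus_arg[OF base(1)]) auto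
    ultimately show "- l (T n g) - l (Tw (rev [1..<n]) (U (Tw [1..<n] g))) = l (crd n * g)"
      by (simp only: crd_n_eq[OF g])
  qed
next
  case (step k)
  have IH: "rep (- dual.Y (Suc k) f) (\<lambda>g. l (crd (Suc k) * g))" if "rep f l" for f l
    by (rule step.IH) (use that in auto)
  have f: "f \<in> V" using step.prems rep_polys by blast
  have k: "1 \<le> k" "k \<le> n" "k < n" using step.hyps step.prems by auto
  have "rep (dual.T k f) (\<lambda>g. l (T k g))" using step.prems k by (intro rep_T) auto
  then have "rep (dual.T k (- dual.Y (Suc k) (dual.T k f)) - cst t * dual.T k f)
    (\<lambda>g. l (T k (crd (Suc k) * T k g)) - t * l (T k g))"
    using k by (intro rep_T IH rep_diff rep_cst_mult step.prems(1)) auto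
  moreover have "dual.T k (- dual.Y (Suc k) (dual.T k f)) - cst t * dual.T k f = - dual.Y k f"
    using f k by (simp add: dual.Y_step)
  ultimately have "rep (- dual.Y k f) (\<lambda>g. l (T k (crd (Suc k) * T k g)) - t * l (T k g))"
    by simp
  then show "rep (- dual.Y k f) (\<lambda>g. l (crd k * g))"
  proof (rule rep.eq_on)
    fix g assume g: "g \<in> V"
    have "T k (crd (Suc k) * T k g) = crd k * g + cst t * T k g"
      using T_crd[of "T k g" k] T_T_1[of g k] g k by simp
    moreover have "l (crd k * g + cst t * T k g) = l (crd k * g) + l (cst t * T k g)"
      by (rule rep_add_arg[OF step.prems(1)]) (use g k in auto)
    moreover have "l (cst t * T k g) = t * l (T k g)"
      by (rule rep_cst_mult_arg[OF step.prems(1)]) (use g k in auto)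
    ultimately show "l (T k (crd (Suc k) * T k g)) - t * l (T k g) = l (crd k * g)"
      by (simp only: add_diff_cancel_right')
  qed
qed

text \<open>
  Quantifying over the pair \<open>z = (f, l)\<close> instead of \<open>f\<close> and \<open>l\<close> avoids a function
  variable in head position, on which unification would diverge.
\<close>

lemma rep_symmetric_pair:
  assumes "dual.rep g m" "rep (fst z) (snd z)"
  shows "snd z g = m (fst z)"
  using assms
proof (induction arbitrary: z rule: dual.rep_induct)
  case (const k)
  have "snd z (cst k * 1) = k * snd z 1" by (rule rep_cst_mult_arg[OF const.prems one_polys])
  moreover have "snd z 1 = fst z (- gamma0 n P)" by (rule rep_one[OF const.prems])
  ultimately show "snd z (cst k) = k * fst z (- gamma0 n (sigma (sigma P)))" by simp
next
  case (crd g m i)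
  \<comment> \<open>The factor \<open>X_i\<close> moves to the other argument as the dual
    \<open>- Y_i\<close>; the induction hypothesis is then needed at this new pair.\<close>
  have "rep (- dual.Y i (fst z)) (\<lambda>g. snd z (crd i * g))"
    by (rule rep_Y[OF crd.prems crd.hyps(3,2)])
  then have "snd z (crd i * g) = m (- dual.Y i (fst z))"
    using crd.IH[of "(- dual.Y i (fst z), \<lambda>g. snd z (crd i * g))"] by (simp only: fst_conv snd_conv)
  also have "\<dots> = - m (dual.Y i (fst z))"
    by (rule dual.rep_uminus_arg[OF crd.hyps(1)])
      (use crd.hyps(3) rep_polys[OF crd.prems] in simp)
  finally show "snd z (crd i * g) = - m (dual.Y i (fst z))" .
next
  case (add g m g' m')
  have "snd z (g + g') = snd z g + snd z g'"
    by (rule rep_add_arg[OF add.prems dual.rep_polys[OF add.hyps(1)] dual.rep_polys[OF add.hyps(2)]])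
  then show "snd z (g + g') = m (fst z) + m' (fst z)"
    by (simp only: add.IH[OF add.prems])
next
  case (eq_on g m m')
  have "snd z g = m (fst z)" by (rule eq_on.IH[OF eq_on.prems])
  also have "\<dots> = m' (fst z)" by (rule eq_on.hyps(2)[OF rep_polys[OF eq_on.prems]])
  finally show "snd z g = m' (fst z)" .
qed

lemma rep_symmetric: "rep f l \<Longrightarrow> dual.rep g m \<Longrightarrow> l g = m f"
  using rep_symmetric_pair[of g m "(f, l)"] by simp

text \<open>The pairing of \<open>w\<close> with \<open>v\<close>, computed by
  \<open>rep_eigen\<close> from either side.\<close>

lemma eigen_symmetric:
  assumes "v \<in> V" "\<And>i. 1 \<le> i \<Longrightarrow> i \<le> n \<Longrightarrow> Y i v = cst (g i) * v"
    and "w \<in> V" "\<And>i. 1 \<le> i \<Longrightarrow> i \<le> n \<Longrightarrow> dual.Y i w = cst (h i) * w"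
  shows "w (- g) * v (- gamma0 n (sigma P)) = v (- h) * w (- gamma0 n P)"
proof -
  obtain l where l: "rep w l" using rep_ex[OF assms(3)] by blast
  obtain m where m: "dual.rep v m" using dual.rep_ex[OF assms(1)] by blast
  have "l v = w (- g) * v (- gamma0 n (sigma P))" by (rule rep_eigen[OF l assms(1,2)])
  moreover have "m w = v (- h) * w (- gamma0 n P)"
    using dual.rep_eigen[OF m assms(3,4)] by simp
  ultimately show ?thesis using rep_symmetric[OF l m] by simp
qed

section \<open>Intertwiners\<close>


lemma aY_op_eq:
  "aY_op n P i p = (if i = 0 then p - cst 2 * Y 1 p else if i = n then cst 2 * Y n p
     else Y i p - Y (i+1) p)"
  by (simp add: aY_op_def fun_eq_iff)

text \<open>On an eigenvector the cross relation turns the commutator into a combination of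
  \<open>U v\<close> and \<open>v\<close>; the next two lemmas do the same with
  \<open>T_j v\<close>.\<close>

lemma S_gen_0_eigen:
  assumes "v \<in> V" "Y 1 v = cst k * v"
  shows "S_gen n P 0 v
    = cst (-4 * k - 2) * U v + cst (2 * (u0\<^sup>2 - un\<^sup>2 - 1/4 - k - k\<^sup>2)) * v"
proof -
  have "S_gen n P 0 v = U (v - cst 2 * Y 1 v) - (U v - cst 2 * Y 1 (U v))"
    by (simp add: S_gen_def commutator_def aY_op_eq fun_eq_iff)
  also have "v - cst 2 * Y 1 v = cst (1 - 2 * k) * v"
    using assms by (simp add: fun_eq_iff algebra_simps)
  also have "U \<dots> = cst (1 - 2 * k) * U v" using assms by simp
  also have "Y 1 (U v) = - (cst k * U v) + cst (u0\<^sup>2 - un\<^sup>2 - 1/4) * v - cst k * v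
      - cst k * (cst k * v) - U v"
    using assms n2 by (simp add: Y_1_U[simplified])
  finally show ?thesis by (simp add: fun_eq_iff algebra_simps power2_eq_square)
qed

lemma S_gen_n_eigen:
  assumes "v \<in> V" "Y n v = cst k * v"
  shows "S_gen n P n v = cst (4 * k) * T n v - cst (2 * (tn\<^sup>2 - t0\<^sup>2 + k\<^sup>2)) * v"
proof -
  have "S_gen n P n v = T n (cst 2 * Y n v) - cst 2 * Y n (T n v)"
    using n2 by (simp add: S_gen_def commutator_def aY_op_eq fun_eq_iff)
  also have "cst 2 * Y n v = cst (2 * k) * v"
    using assms by (simp add: fun_eq_iff algebra_simps)
  also have "T n \<dots> = cst (2 * k) * T n v" using assms by simp
  also have "Y n (T n v) = - (cst k * T n v) + cst (tn\<^sup>2 - t0\<^sup>2) * v + cst k * (cst k * v)"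
    using assms n2 by (simp add: Y_n_T)
  finally show ?thesis by (simp add: fun_eq_iff algebra_simps power2_eq_square)
qed

lemma S_gen_mid_eigen:
  assumes "v \<in> V" "1 \<le> j" "j < n" "Y j v = cst k * v" "Y (j + 1) v = cst k' * v"
  shows "S_gen n P j v = cst (2 * (k - k')) * T j v - cst (2 * t) * v"
proof -
  have "S_gen n P j v = T j (Y j v - Y (j+1) v) - (Y j (T j v) - Y (j+1) (T j v))"
    using assms by (simp add: S_gen_def commutator_def aY_op_eq fun_eq_iff)
  also have "Y j v - Y (j+1) v = cst (k - k') * v"
    using assms by (simp add: fun_eq_iff algebra_simps)
  also have "T j \<dots> = cst (k - k') * T j v" using assms by simp
  also have "Y j (T j v) = cst k' * T j v + cst t * v" using assms Y_T[of v j] by simp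
  also have "Y (j+1) (T j v) = cst k * T j v - cst t * v" using assms Y_T'[of v j] by simp
  finally show ?thesis by (simp add: fun_eq_iff algebra_simps)
qed

lemma Y_diff [simp]: "p \<in> V \<Longrightarrow> q \<in> V \<Longrightarrow> 1 \<le> i \<Longrightarrow> i \<le> n \<Longrightarrow> Y i (p - q) = Y i p - Y i q"
proof -
  assume *: "p \<in> V" "q \<in> V" "1 \<le> i" "i \<le> n"
  have "Y i (p + cst (-1) * q) = Y i p + cst (-1) * Y i q" using * by simp
  moreover have "p + cst (-1) * q = p - q" for p q by (simp add: fun_eq_iff)
  ultimately show ?thesis by simp
qed

text \<open>The coefficient of \<open>v\<close> in these combinations is the one that cancels the
  inhomogeneous terms of the cross relation. The image may be zero; only the equation is
  claimed.\<close>

lemma S_gen_eigen: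
  assumes v: "v \<in> V" and Yv: "\<And>i. 1 \<le> i \<Longrightarrow> i \<le> n \<Longrightarrow> Y i v = cst (g i) * v"
    and j: "j \<le> n"
  shows "S_gen n P j v \<in> V"
    and "1 \<le> i \<Longrightarrow> i \<le> n \<Longrightarrow> Y i (S_gen n P j v) = cst (dot_gen n j g i) * S_gen n P j v"
proof -
  consider (0) "j = 0" | (n) "j = n" "j \<noteq> 0" | (mid) "1 \<le> j" "j < n" using j by linarith
  then have "S_gen n P j v \<in> V \<and> (1 \<le> i \<longrightarrow> i \<le> n \<longrightarrow>
    Y i (S_gen n P j v) = cst (dot_gen n j g i) * S_gen n P j v)"
  proof cases
    case 0
    have S: "S_gen n P j v
      = cst (-4 * g 1 - 2) * U v + cst (2 * (u0\<^sup>2 - un\<^sup>2 - 1/4 - g 1 - (g 1)\<^sup>2)) * v"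
      unfolding 0 by (rule S_gen_0_eigen) (use v Yv[of 1] n2 in auto)
    show ?thesis
    proof (intro conjI impI)
      assume i: "1 \<le> i" "i \<le> n"
      show "Y i (S_gen n P j v) = cst (dot_gen n j g i) * S_gen n P j v"
      proof (cases "i = 1")
        case True
        then show ?thesis unfolding S using v Yv[of 1] n2 0
          by (simp add: Y_1_U[simplified] dot_gen_def)
            (simp add: fun_eq_iff algebra_simps power2_eq_square)
      next
        case False
        then show ?thesis unfolding S using v Yv[of i] i 0
          by (simp add: U_Y dot_gen_def) (simp add: fun_eq_iff algebra_simps)
      qed
    qed (use v S in simp)
  next
    case n
    have S: "S_gen n P j v
      = cst (4 * g n) * T n v - cst (2 * (tn\<^sup>2 - t0\<^sup>2 + (g n)\<^sup>2)) * v"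
      unfolding n by (rule S_gen_n_eigen) (use v Yv[of n] n2 in auto)
    show ?thesis
    proof (intro conjI impI)
      assume i: "1 \<le> i" "i \<le> n"
      show "Y i (S_gen n P j v) = cst (dot_gen n j g i) * S_gen n P j v"
      proof (cases "i = n")
        case True
        then show ?thesis unfolding S using v Yv[of n] n2 n
          by (simp add: Y_n_T dot_gen_def refl_gen_def)
            (simp add: fun_eq_iff algebra_simps power2_eq_square)
      next
        case False
        then show ?thesis unfolding S using v Yv[of i] i n
          by (simp add: Y_T_far dot_gen_def refl_gen_def) (simp add: fun_eq_iff algebra_simps)
      qed
    qed (use v S in simp)
  next
    case mid
    have S: "S_gen n P j v = cst (2 * (g j - g (j+1))) * T j v - cst (2 * t) * v"
      by (rule S_gen_mid_eigen) (use v Yv[of j] Yv[of "j+1"] mid in auto)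
    show ?thesis
    proof (intro conjI impI)
      assume i: "1 \<le> i" "i \<le> n"
      show "Y i (S_gen n P j v) = cst (dot_gen n j g i) * S_gen n P j v"
      proof -
        consider "i = j" | "i = j + 1" | "i \<noteq> j" "i \<noteq> j + 1" by blast
        then show ?thesis
        proof cases
          case 1
          then show ?thesis unfolding S using v Yv[of j] Yv[of "j+1"] mid i Y_T[of v j]
            by (simp add: dot_gen_def refl_gen_def) (simp add: fun_eq_iff algebra_simps)
        next
          case 2
          then show ?thesis unfolding S using v Yv[of j] Yv[of "j+1"] mid i Y_T'[of v j]
            by (simp add: dot_gen_def refl_gen_def) (simp add: fun_eq_iff algebra_simps)
        next
          case 3
          then show ?thesis unfolding S using v Yv[of i] mid i
            by (simp add: Y_T_far dot_gen_def refl_gen_def transpose_def)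
              (simp add: fun_eq_iff algebra_simps)
        qed
      qed
    qed (use v S mid in simp)
  qed
  then show "S_gen n P j v \<in> V"
    "1 \<le> i \<Longrightarrow> i \<le> n \<Longrightarrow> Y i (S_gen n P j v) = cst (dot_gen n j g i) * S_gen n P j v"
    by auto
qed

text \<open>Iterates \<open>S_gen_eigen\<close> from the constant 1. Polynomial and eigenvalue are
  read along the same word, as in \<open>wilson\<close> and \<open>gam\<close>.\<close>

lemma S_word_eigen:
  assumes "set w \<subseteq> {0..n}"
  shows "word_comp (S_gen n P) w 1 \<in> V \<and> (\<forall>i. 1 \<le> i \<longrightarrow> i \<le> n \<longrightarrow>
    Y i (word_comp (S_gen n P) w 1)
      = cst (word_comp (dot_gen n) w (gamma0 n P) i) * word_comp (S_gen n P) w 1)"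
  using assms
proof (induction w)
  case Nil
  show "word_comp (S_gen n P) [] 1 \<in> V \<and> (\<forall>i. 1 \<le> i \<longrightarrow> i \<le> n \<longrightarrow>
    Y i (word_comp (S_gen n P) [] 1)
      = cst (word_comp (dot_gen n) [] (gamma0 n P) i) * word_comp (S_gen n P) [] 1)"
    by (simp add: word_comp_def Y_one)
next
  case (Cons j w)
  define v where "v = word_comp (S_gen n P) w 1"
  define g where "g = word_comp (dot_gen n) w (gamma0 n P)"
  have "v \<in> V \<and> (\<forall>i. 1 \<le> i \<longrightarrow> i \<le> n \<longrightarrow> Y i v = cst (g i) * v)"
    unfolding v_def g_def by (rule Cons.IH) (use Cons.prems in auto)
  then have "v \<in> V" "\<And>i. 1 \<le> i \<Longrightarrow> i \<le> n \<Longrightarrow> Y i v = cst (g i) * v" by auto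
  from S_gen_eigen[OF this, of j] Cons.prems
  have "S_gen n P j v \<in> V" "1 \<le> i \<Longrightarrow> i \<le> n \<Longrightarrow>
      Y i (S_gen n P j v) = cst (dot_gen n j g i) * S_gen n P j v" for i by auto
  then show "word_comp (S_gen n P) (j # w) 1 \<in> V \<and> (\<forall>i. 1 \<le> i \<longrightarrow> i \<le> n \<longrightarrow>
    Y i (word_comp (S_gen n P) (j # w) 1)
      = cst (word_comp (dot_gen n) (j # w) (gamma0 n P) i) * word_comp (S_gen n P) (j # w) 1)"
    by (simp add: word_comp_def v_def g_def)
qed

end

section \<open>The Weyl group\<close>

lemma reduced_expr_expression:
  assumes "w \<in> Weyl n"
  shows "expression n w (reduced_expr n w)"
proof -
  from assms have "\<exists>r is. expression n w is \<and> length is = r"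
    by (auto simp: Weyl_def expression_def)
  then have "\<exists>is. expression n w is \<and> length is = wlength n w"
    unfolding wlength_def by (rule LeastI_ex)
  then show ?thesis unfolding reduced_expr_def by (metis (mono_tags, lifting) someI_ex)
qed

lemma dot_word:
  assumes "n \<ge> 1" "set w \<subseteq> {0..n}"
  shows "dot n (word_comp (refl_gen n) w) = word_comp (dot_gen n) w"
proof -
  have "word_comp (refl_gen n) w \<in> Weyl n" using assms by (auto simp: Weyl_def)
  from reduced_expr_expression[OF this] show ?thesis
    unfolding dot_def expression_def using assms by (intro dot_word_cong) auto
qed

section \<open>The lattice lies in the dot orbit of 0\<close>

definition dot_orbit :: "nat \<Rightarrow> point set" where
  "dot_orbit n = {word_comp (dot_gen n) w (\<lambda>_. 0) | w. set w \<subseteq> {0..n}}"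

lemma dot_orbit_zero: "(\<lambda>_. 0) \<in> dot_orbit n"
  unfolding dot_orbit_def by (rule CollectI, rule exI[of _ "[]"]) (simp add: word_comp_def)

lemma dot_orbit_gen:
  assumes "dot_gen n i x \<in> dot_orbit n" "i \<le> n"
  shows "x \<in> dot_orbit n"
proof -
  obtain w where w: "set w \<subseteq> {0..n}" "dot_gen n i x = word_comp (dot_gen n) w (\<lambda>_. 0)"
    using assms unfolding dot_orbit_def by auto
  have "dot_gen n i (dot_gen n i x) = x"
    by (auto simp: dot_gen_def refl_gen_def fun_eq_iff)
  then have "x = word_comp (dot_gen n) (i # w) (\<lambda>_. 0)"
    using w(2) by (simp add: word_comp_def)
  then show ?thesis using w(1) assms(2) unfolding dot_orbit_def
    by (intro CollectI exI[of _ "i # w"]) auto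
qed

text \<open>Descent on the sum of absolute values. A negative coordinate is moved to position 1,
  where \<open>dot_gen n 0\<close> lowers the sum; a positive one is moved to position
  \<open>n\<close> and its sign is flipped. Swaps and sign changes preserve the sum.\<close>

lemma Lam_dot_orbit_aux:
  fixes f :: "nat \<Rightarrow> int"
  assumes "n \<ge> 1" "\<And>i. i \<notin> {1..n} \<Longrightarrow> f i = 0"
  shows "(\<lambda>i. of_int (f i)) \<in> dot_orbit n"
  using assms(2)
proof (induction "\<Sum>i=1..n. nat \<bar>f i\<bar>" arbitrary: f rule: less_induct)
  case less
  define m where "m h = (\<Sum>i=1..n. nat \<bar>h i\<bar>)" for h :: "nat \<Rightarrow> int"
  have IH: "(\<lambda>i. of_int (h i)) \<in> dot_orbit n"
    if "m h < m f" "\<And>i. i \<notin> {1..n} \<Longrightarrow> h i = 0" for h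
    using less.hyps[of h] that unfolding m_def by blast
  have swap: "m (h \<circ> transpose k (k+1)) = m h" if "1 \<le> k" "k < n" for h k
    unfolding m_def
    by (rule sum.reindex_bij_witness[of _ "transpose k (k+1)" "transpose k (k+1)"])
      (use that in \<open>auto simp: transpose_def\<close>)
  have neg: "(\<lambda>i. of_int (h i)) \<in> dot_orbit n"
    if "1 \<le> k" "k \<le> n" "h k < 0" "m h \<le> m f" "\<And>i. i \<notin> {1..n} \<Longrightarrow> h i = 0" for h k
    using that
  proof (induction k arbitrary: h rule: nat_induct_at_least)
    case base
    \<comment> \<open>For \<open>h 1 < 0\<close> the new entry has absolute value one less than that
      of \<open>h 1\<close>.\<close>
    let ?h = "h(1 := - h 1 - 1)"
    have "m ?h < m h" unfolding m_def
      by (rule sum_strict_mono_ex1) (use base assms(1) in auto)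
    then have "m ?h < m f" using base.prems(3) by linarith
    moreover have "?h i = 0" if "i \<notin> {1..n}" for i
      using base.prems(4)[OF that] that assms(1) by auto
    ultimately have "(\<lambda>i. of_int (?h i)) \<in> dot_orbit n" by (rule IH)
    moreover have "(\<lambda>i. of_int (?h i)) = dot_gen n 0 (\<lambda>i. of_int (h i))"
      by (auto simp: dot_gen_def fun_eq_iff)
    ultimately show "(\<lambda>i. of_int (h i)) \<in> dot_orbit n" using dot_orbit_gen[of n 0] by auto
  next
    case (Suc k)
    let ?h = "h \<circ> transpose k (k+1)"
    have "(\<lambda>i. of_int (?h i)) \<in> dot_orbit n"
    proof (rule Suc.IH)
      show "m ?h \<le> m f" using swap[of k h] Suc.prems Suc.hyps by linarith
    qed (use Suc.prems Suc.hyps in \<open>auto simp: transpose_def\<close>)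
    moreover have "(\<lambda>i. of_int (?h i)) = dot_gen n k (\<lambda>i. of_int (h i))"
      using Suc.prems Suc.hyps by (auto simp: dot_gen_def refl_gen_def fun_eq_iff)
    ultimately show "(\<lambda>i. of_int (h i)) \<in> dot_orbit n"
      using dot_orbit_gen[of n k] Suc.prems by auto
  qed
  have pos: "(\<lambda>i. of_int (h i)) \<in> dot_orbit n"
    if "k \<le> n" "1 \<le> k" "h k > 0" "m h \<le> m f" "\<And>i. i \<notin> {1..n} \<Longrightarrow> h i = 0" for h k
    using that
  proof (induction k arbitrary: h rule: inc_induct)
    case base
    let ?h = "h(n := - h n)"
    have m: "m ?h = m h" unfolding m_def by (rule sum.cong) auto
    have "(\<lambda>i. of_int (?h i)) \<in> dot_orbit n"
    proof (rule neg)
      show "m ?h \<le> m f" using m base by simp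
      show "1 \<le> n" "n \<le> n" "?h n < 0" using base by auto
      show "?h i = 0" if "i \<notin> {1..n}" for i using base that by auto
    qed
    moreover have "(\<lambda>i. of_int (?h i)) = dot_gen n n (\<lambda>i. of_int (h i))"
      using base by (auto simp: dot_gen_def refl_gen_def fun_eq_iff)
    ultimately show "(\<lambda>i. of_int (h i)) \<in> dot_orbit n" using dot_orbit_gen[of n n] by auto
  next
    case (step k)
    let ?h = "h \<circ> transpose k (k+1)"
    have "(\<lambda>i. of_int (?h i)) \<in> dot_orbit n"
    proof (rule step.IH)
      show "m ?h \<le> m f" using swap[of k h] step.prems step.hyps by linarith
    qed (use step.prems step.hyps in \<open>auto simp: transpose_def\<close>)
    moreover have "(\<lambda>i. of_int (?h i)) = dot_gen n k (\<lambda>i. of_int (h i))"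
      using step.prems step.hyps by (auto simp: dot_gen_def refl_gen_def fun_eq_iff)
    ultimately show "(\<lambda>i. of_int (h i)) \<in> dot_orbit n"
      using dot_orbit_gen[of n k] step.hyps by auto
  qed
  show "(\<lambda>i. of_int (f i)) \<in> dot_orbit n"
  proof (cases "f = (\<lambda>_. 0)")
    case True
    then show ?thesis using dot_orbit_zero by simp
  next
    case False
    then obtain k where "f k \<noteq> 0" by auto
    moreover from this have "k \<in> {1..n}" using less.prems by blast
    ultimately show ?thesis using neg[of k f] pos[of k f] less.prems by (cases "f k < 0") auto
  qed
qed

lemma Lam_dot_orbit:
  assumes "n \<ge> 1" "lam \<in> Lam n"
  shows "lam \<in> dot_orbit n"
proof -
  have "lam i \<in> \<int>" for i using assms by (cases "i \<in> {1..n}") (auto simp: Lam_def)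
  then have "\<forall>i. \<exists>k. lam i = of_int k" by (metis Ints_cases)
  then obtain f where f: "\<And>i. lam i = of_int (f i)" by metis
  have "(\<lambda>i. of_int (f i)) \<in> dot_orbit n"
  proof (rule Lam_dot_orbit_aux[OF assms(1)])
    fix i assume "i \<notin> {1..n}"
    then have "lam i = 0" using assms(2) unfolding Lam_def by blast
    then show "f i = 0" by (simp add: f)
  qed
  then show ?thesis by (simp add: f[symmetric])
qed

text \<open>\<open>ARG_MIN\<close> yields a member only of a nonempty set;
  \<open>Lam_dot_orbit\<close> supplies a candidate.\<close>

lemma u_elt_Weyl:
  assumes "n \<ge> 1" "lam \<in> Lam n"
  shows "u_elt n lam \<in> Weyl n"
proof -
  obtain w where w: "set w \<subseteq> {0..n}" "lam = word_comp (dot_gen n) w (\<lambda>_. 0)"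
    using Lam_dot_orbit[OF assms] unfolding dot_orbit_def by blast
  let ?u = "word_comp (refl_gen n) w"
  let ?A = "\<lambda>w. w \<in> Weyl n \<and> dot n w (\<lambda>_. 0) = lam"
  have "?A ?u" using w dot_word[OF assms(1) w(1)] by (auto simp: Weyl_def)
  then have "?A (arg_min (wlength n) ?A)" by (rule arg_min_natI[of ?A])
  then show ?thesis unfolding u_elt_def by blast
qed

section \<open>Duality\<close>

context wilson_ops
begin

lemma wilson_eigen:
  assumes "lam \<in> Lam n"
  shows "wilson n P lam \<in> V"
    and "1 \<le> i \<Longrightarrow> i \<le> n \<Longrightarrow> Y i (wilson n P lam) = cst (gam n P lam i) * wilson n P lam"
proof -
  let ?w = "reduced_expr n (u_elt n lam)"
  have "set ?w \<subseteq> {0..n}"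
    using reduced_expr_expression[OF u_elt_Weyl[OF _ assms]] n2 by (simp add: expression_def)
  moreover have "wilson n P lam = word_comp (S_gen n P) ?w 1"
    by (simp add: wilson_def S_op_def one_fun_def)
  moreover have "gam n P lam = word_comp (dot_gen n) ?w (gamma0 n P)"
    by (simp add: gam_def dot_def)
  ultimately show "wilson n P lam \<in> V"
    "1 \<le> i \<Longrightarrow> i \<le> n \<Longrightarrow> Y i (wilson n P lam) = cst (gam n P lam i) * wilson n P lam"
    using S_word_eigen by auto
qed

end

text \<open>Injectivity of \<open>gam\<close> recovers \<open>lam\<close> from the spectral point
  and the nonzero value fixes the scalar, so the \<open>THE\<close> in \<open>E_fun\<close> is
  determined.\<close>

lemma E_fun_eq:
  assumes "\<And>mu. mu \<in> Lam n \<Longrightarrow> lam \<noteq> mu \<Longrightarrow> gam n P lam \<noteq> gam n P mu" "lam \<in> Lam n"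
    and "wilson n P lam (- gamma0 n (sigma P)) \<noteq> 0"
  shows "E_fun n P (gam n P lam) = (\<lambda>x. wilson n P lam x / wilson n P lam (- gamma0 n (sigma P)))"
  unfolding E_fun_def
proof (rule the_equality, goal_cases)
  case 1
  show ?case using assms(2,3)
    by (auto intro!: bexI[of _ lam] exI[of _ "1 / wilson n P lam (- gamma0 n (sigma P))"])
next
  case (2 f)
  then obtain mu k where "mu \<in> Lam n" "gam n P lam = gam n P mu"
    and f: "f = (\<lambda>x. k * wilson n P mu x)" "f (- gamma0 n (sigma P)) = 1" by blast
  then have "mu = lam" using assms(1) by blast
  then have f': "f = (\<lambda>x. k * wilson n P lam x)" using f(1) by simp
  then have "k = 1 / wilson n P lam (- gamma0 n (sigma P))"
    using f(2) assms(3) by (simp add: eq_divide_eq)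
  then show ?case unfolding f' by simp
qed

theorem theorem5p3:
  fixes n :: nat and t0 u0 t tn un :: complex and P Q :: params
  defines "P \<equiv> Params t0 u0 t tn un"
  defines "Q \<equiv> sigma P"
  assumes "n \<ge> 2"
    and gen_gamma: "\<And>lam mu. lam \<in> Lam n \<Longrightarrow> mu \<in> Lam n \<Longrightarrow> lam \<noteq> mu \<Longrightarrow> gam n P lam \<noteq> gam n P mu"
    and gen_x: "\<And>lam mu. lam \<in> Lam n \<Longrightarrow> mu \<in> Lam n \<Longrightarrow> lam \<noteq> mu \<Longrightarrow> gam n Q lam \<noteq> gam n Q mu"
    and "\<And>lam. lam \<in> Lam n \<Longrightarrow> wilson n P lam (- gamma0 n Q) \<noteq> 0"
    and "\<And>lam. lam \<in> Lam n \<Longrightarrow> wilson n Q lam (- gamma0 n P) \<noteq> 0"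
    and "lam \<in> Lam n" and "mu \<in> Lam n"
  shows "E_fun n P (gam n P lam) (- gam n Q mu) = E_fun n Q (gam n Q mu) (- gam n P lam)"
proof -
  interpret P: wilson_ops n P by unfold_locales (rule \<open>n \<ge> 2\<close>)
  interpret Q: wilson_ops n Q by unfold_locales (rule \<open>n \<ge> 2\<close>)
  have Q: "sigma P = Q" "sigma Q = P" by (simp_all add: Q_def)
  \<comment> \<open>The claim with the two nonzero normalizing values multiplied out.\<close>
  have "wilson n Q mu (- gam n P lam) * wilson n P lam (- gamma0 n Q)
      = wilson n P lam (- gam n Q mu) * wilson n Q mu (- gamma0 n P)"
    unfolding Q(1)[symmetric]
    by (rule P.eigen_symmetric)
      (use P.wilson_eigen[OF \<open>lam \<in> Lam n\<close>] Q.wilson_eigen[OF \<open>mu \<in> Lam n\<close>] in \<open>simp_all add: Q\<close>)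
  moreover have "E_fun n P (gam n P lam) = (\<lambda>x. wilson n P lam x / wilson n P lam (- gamma0 n Q))"
    using E_fun_eq[of n lam P] assms by (simp add: Q)
  moreover have "E_fun n Q (gam n Q mu) = (\<lambda>x. wilson n Q mu x / wilson n Q mu (- gamma0 n P))"
    using E_fun_eq[of n mu Q] assms by (simp add: Q)
  ultimately show ?thesis using assms by (simp add: field_simps)
qed

end
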